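(* Suppose Assumptions (H0), (H1) and (H3) hold. Let $\bar w:[0,T]\times\mathbb R^d\times\mathcal I\to\mathbb R$ be lower semicontinuous and a viscosity supersolution of $(\ast)$ and $(\ast\ast)$, and let $\bar u:[0,T]\times\mathbb R^d\times\mathcal I\to\mathbb R$ be upper semicontinuous and a viscosity subsolution of $(\ast)$ and $(\ast\ast)$. Suppose there exists $q>0$ with $$\sup_{(t,x,i)\in[0,T]\times\mathbb R^d\times\mathcal I}\frac{|\bar w_i(t,x)|+|\bar u_i(t,x)|}{1+|x|^{q}}<\infty\quad\text{and}\quad\sup_{(t,x)\in[0,T]\times\mathbb R^d}\big(|\bar w_i(t,x)|+|\bar u_i(t,x)|\big)\xrightarrow[|i|\to\infty]{}0.$$ Then $\bar u_i(t,x)\le\bar w_i(t,x)$ for all $(t,x,i)\in[0,T]\times\mathbb R^d\times\mathcal I$.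
   Context: Labels $\mathcal I=\{\varnothing\}\cup\bigcup_{n\ge1}\mathbb N^n$ (finite words over $\mathbb N$), concatenation $ij$ ($ik$ = word $i$ followed by $k$); for $i=i_1\cdots i_n$, $|i|=\sum_{\ell=1}^n(i_\ell+1)$, $|\varnothing|=0$. Branching parameters $\gamma>0$, $p_k\ge0$, $\sum_kp_k=1$; $\bar K=\sup\{k+1:p_k>0\}\in\mathbb N\cup\{\infty\}$. $A$ is a Polish space with bounded metric $d_A$. Measurable coefficients $\lambda:\mathbb R^d\times A\to\mathbb R^d$, $\sigma:\mathbb R^d\times A\to\mathbb R^{d\times m}$, $\lambda_Y:\mathbb R^d\times\mathbb R\times A\to\mathbb R$, $\sigma_Y:\mathbb R^d\times A\to\mathbb R^{1\times m}$; $g:\mathcal I\times\mathbb R^d\to\mathbb R$, $(i,x)\mapsto g_i(x)$. Operator: $N^a(x,p)=\sigma_Y(x,a)-\sigma(x,a)^\top p$, $\mathcal N_\varepsilon(x,p)=\{a\in A:|N^a(x,p)|\le\varepsilon\}$. For $\Theta=(x,y,p,M)$, $F_\varepsilon(\Theta)=\sup\{\lambda_Y(x,y,a)-\lambda(x,a)^\top p-\frac12\mathrm{Tr}(\sigma\sigma^\top(x,a)M):a\in\mathcal N_\varepsilon(x,p)\}$ ($\sup\emptyset=-\infty$), $F=F_0$, $F^*(\Theta)=\limsup_{\varepsilon\to0,\Theta'\to\Theta}F_\varepsilon(\Theta')$, $F_*(\Theta)=\liminf_{\varepsilon\to0,\Theta'\to\Theta}F_\varepsilon(\Theta')$; $F^*\varphi(t,x)=F^*(x,\varphi(t,x),D\varphi(t,x),D^2\varphi(t,x))$,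 same for $F_*$. Envelopes: $u_{i,*}(t,x)=\liminf_{(t',x')\to(t,x),t'<T}u_i(t',x')$, $u^*_i(t,x)=\limsup_{(t',x')\to(t,x),t'<T}u_i(t',x')$. Interior equation $(\ast)$: $\min\{-\partial_tw_i+F(x,w_i,Dw_i,D^2w_i);\ w_i-\sup_{0\le k<\bar K}w_{ik}\}=0$ on $[0,T)\times\mathbb R^d\times\mathcal I$. Test data at $(t_0,x_0,i_0)\in[0,T)\times\mathbb R^d\times\mathcal I$: a family $\varphi_i\in C^{1,2}([0,T]\times\mathbb R^d)$, $i\in\mathcal I$, and $\bar\varphi\in C^0([0,T]\times\mathbb R^d)$ with $\sup_i|\varphi_i|\le\bar\varphi$. $u$ is a supersolution of $(\ast)$ if whenever $0=(u_{i_0,*}-\varphi_{i_0})(t_0,x_0)=\min_{\mathcal I\times[0,T]\times\mathbb R^d}(u_{\cdot,*}-\varphi_\cdot)$, then $\min\{-\partial_t\varphi_{i_0}(t_0,x_0)+F^*\varphi_{i_0}(t_0,x_0);\ (\varphi_{i_0}-\sup_{0\le k<\bar K}\varphi_{i_0k})(t_0,x_0)\}\ge0$; a subsolution if whenever $0=(u^*_{i_0}-\varphi_{i_0})(t_0,x_0)=\max_{\mathcal I\times[0,T]\times\mathbb R^d}(u^*_\cdot-\varphi_\cdot)$, then the same min with $F_*$ in place of $F^*$ is $\le0$. Terminal condition $(\ast\ast)$ at $t=T$: test data at $(x_0,i_0)\in\mathbb R^d\times\mathcal I$ are $\varphi_i\in C^2(\mathbb R^d)$ and $\bar\varphi\in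 C^0(\mathbb R^d)$ with $\sup_i|\varphi_i|\le\bar\varphi$. $u$ is a supersolution of $(\ast\ast)$ if whenever $0=u_{i_0}(T,x_0)-\varphi_{i_0}(x_0)=\min_{(i,x)}(u_i(T,x)-\varphi_i(x))$, then $\min\{\varphi_{i_0}(x_0)-g_{i_0}(x_0);\ \varphi_{i_0}(x_0)-\sup_{0\le k<\bar K}\varphi_{i_0k}(x_0)\}\ge0$; a subsolution if whenever $0=u_{i_0}(T,x_0)-\varphi_{i_0}(x_0)=\max_{(i,x)}(u_i(T,x)-\varphi_i(x))$, then the same min is $\le0$. Assumption (H0): (i) $\sum_kkp_k<\infty$; (ii) $\sup_a(|\lambda(0,a)|+|\sigma(0,a)|+|\lambda_Y(0,0,a)|+|\sigma_Y(0,a)|)<\infty$; (iii) there is $L$ with $|\lambda(x,a)-\lambda(x',a)|+|\sigma(x,a)-\sigma(x',a)|+|\lambda_Y(x,y,a)-\lambda_Y(x',y',a)|+|\sigma_Y(x,a)-\sigma_Y(x',a)|\le L(|x-x'|+|y-y'|)$; (iv) there is a nondecreasing $w$, $w(r)\to0$ as $r\to0$, with $|\lambda(x,a)-\lambda(x,a')|+|\sigma(x,a)-\sigma(x,a')|+|\lambda_Y(x,y,a)-\lambda_Y(x,y,a')|+|\sigma_Y(x,a)-\sigma_Y(x,a')|\le w(d_A(a,a'))$. Assumption (H1): each $g_i$ is continuous. Assumption (H3): (i) $\lambda,\sigma$ do not depend on $a$; (ii) $w(r)\le Cr^\eta$ for some $C>0$, $\eta\in(0,1]$; (iii) there is $C>0$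 with $d_{\mathcal H}(\mathcal N_\varepsilon(x,p),\mathcal N_{\varepsilon'}(x',p'))\le C(|p-p'|+\varepsilon+\varepsilon')(1+|x|)+C|x-x'|$ for all $\varepsilon,\varepsilon'\ge0$, $x,x',p,p'$, where $d_{\mathcal H}(B,C)=\min\{r\ge0:B\subset C_r,C\subset B_r\}$, $D_r=\{a:\exists a'\in D,d_A(a,a')\le r\}$, $d_{\mathcal H}=+\infty$ if a set is empty; (iv) $\mathcal N_0(0,0)\ne\emptyset$. *)

theory Defs
  imports "HOL-Analysis.Analysis" "HOL-Library.Liminf_Limsup" "HOL-Library.Extended_Nat"
begin

text \<open>Labels are finite words over nat (nat lists); the label ik is i @ [k].
  Dimensions d and m are the finite index types 'd and 'm; the control space A is
  a type of class polish_space, its metric being dist.\<close>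

definition wlen :: "nat list \<Rightarrow> nat" where
  "wlen i = (\<Sum>l\<leftarrow>i. l + 1)"

definition Kbar :: "(nat \<Rightarrow> real) \<Rightarrow> enat" where
  "Kbar p = Sup {enat (k + 1) | k. p k > 0}"

definition lsc_on :: "'z::topological_space set \<Rightarrow> ('z \<Rightarrow> real) \<Rightarrow> bool" where
  "lsc_on S f \<longleftrightarrow> (\<forall>z\<in>S. \<forall>c. c < f z \<longrightarrow> eventually (\<lambda>y. c < f y) (at z within S))"

definition usc_on :: "'z::topological_space set \<Rightarrow> ('z \<Rightarrow> real) \<Rightarrow> bool" where
  "usc_on S f \<longleftrightarrow> (\<forall>z\<in>S. \<forall>c. f z < c \<longrightarrow> eventually (\<lambda>y. f y < c) (at z within S))"

definition Nop ::
  "(real^'d \<Rightarrow> 'a \<Rightarrow> real^'m^'d) \<Rightarrow> (real^'d \<Rightarrow> 'a \<Rightarrow> real^'m)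
   \<Rightarrow> real^'d \<Rightarrow> real^'d \<Rightarrow> 'a \<Rightarrow> real^'m" where
  "Nop sig sigY x p a = sigY x a - transpose (sig x a) *v p"

definition Nset ::
  "(real^'d \<Rightarrow> 'a \<Rightarrow> real^'m^'d) \<Rightarrow> (real^'d \<Rightarrow> 'a \<Rightarrow> real^'m)
   \<Rightarrow> real \<Rightarrow> real^'d \<Rightarrow> real^'d \<Rightarrow> 'a set" where
  "Nset sig sigY eps x p = {a. norm (Nop sig sigY x p a) \<le> eps}"

text \<open>F_eps, with sup of the empty set equal to -infinity (values in ereal).\<close>
definition Feps ::
  "(real^'d \<Rightarrow> 'a \<Rightarrow> real^'d) \<Rightarrow> (real^'d \<Rightarrow> 'a \<Rightarrow> real^'m^'d)
   \<Rightarrow> (real^'d \<Rightarrow> real \<Rightarrow> 'a \<Rightarrow> real) \<Rightarrow> (real^'d \<Rightarrow> 'a \<Rightarrow> real^'m)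
   \<Rightarrow> real \<Rightarrow> real^'d \<Rightarrow> real \<Rightarrow> real^'d \<Rightarrow> real^'d^'d \<Rightarrow> ereal" where
  "Feps lam sig lamY sigY eps x y p M =
     (SUP a\<in>Nset sig sigY eps x p.
        ereal (lamY x y a - lam x a \<bullet> p - trace (sig x a ** transpose (sig x a) ** M) / 2))"

definition Fup ::
  "(real^'d \<Rightarrow> 'a \<Rightarrow> real^'d) \<Rightarrow> (real^'d \<Rightarrow> 'a \<Rightarrow> real^'m^'d)
   \<Rightarrow> (real^'d \<Rightarrow> real \<Rightarrow> 'a \<Rightarrow> real) \<Rightarrow> (real^'d \<Rightarrow> 'a \<Rightarrow> real^'m)
   \<Rightarrow> real^'d \<Rightarrow> real \<Rightarrow> real^'d \<Rightarrow> real^'d^'d \<Rightarrow> ereal" where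
  "Fup lam sig lamY sigY x y p M =
     Limsup (at (0, (x, y, p, M)) within ({0<..} \<times> UNIV))
       (\<lambda>(eps, (x', y', p', M')). Feps lam sig lamY sigY eps x' y' p' M')"

definition Flow ::
  "(real^'d \<Rightarrow> 'a \<Rightarrow> real^'d) \<Rightarrow> (real^'d \<Rightarrow> 'a \<Rightarrow> real^'m^'d)
   \<Rightarrow> (real^'d \<Rightarrow> real \<Rightarrow> 'a \<Rightarrow> real) \<Rightarrow> (real^'d \<Rightarrow> 'a \<Rightarrow> real^'m)
   \<Rightarrow> real^'d \<Rightarrow> real \<Rightarrow> real^'d \<Rightarrow> real^'d^'d \<Rightarrow> ereal" where
  "Flow lam sig lamY sigY x y p M =
     Liminf (at (0, (x, y, p, M)) within ({0<..} \<times> UNIV))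
       (\<lambda>(eps, (x', y', p', M')). Feps lam sig lamY sigY eps x' y' p' M')"

definition thick :: "'a::metric_space set \<Rightarrow> real \<Rightarrow> 'a set" where
  "thick D r = {a. \<exists>a'\<in>D. dist a a' \<le> r}"

definition dH :: "'a::metric_space set \<Rightarrow> 'a set \<Rightarrow> ereal" where
  "dH B C = (if B = {} \<or> C = {} then \<infinity>
             else Inf {ereal r | r. r \<ge> 0 \<and> B \<subseteq> thick C r \<and> C \<subseteq> thick B r})"

definition C12 ::
  "real \<Rightarrow> (real \<Rightarrow> real^'d \<Rightarrow> real) \<Rightarrow> (real \<Rightarrow> real^'d \<Rightarrow> real)
   \<Rightarrow> (real \<Rightarrow> real^'d \<Rightarrow> real^'d) \<Rightarrow> (real \<Rightarrow> real^'d \<Rightarrow> real^'d^'d) \<Rightarrow> bool" where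
  "C12 T phi phit Dphi D2phi \<longleftrightarrow>
     (\<forall>t\<in>{0..T}. \<forall>x.
        ((\<lambda>s. phi s x) has_real_derivative phit t x) (at t within {0..T})
      \<and> ((\<lambda>z. phi t z) has_derivative (\<lambda>h. Dphi t x \<bullet> h)) (at x)
      \<and> ((\<lambda>z. Dphi t z) has_derivative (\<lambda>h. D2phi t x *v h)) (at x))
   \<and> continuous_on ({0..T} \<times> UNIV) (\<lambda>(t, x). phi t x)
   \<and> continuous_on ({0..T} \<times> UNIV) (\<lambda>(t, x). phit t x)
   \<and> continuous_on ({0..T} \<times> UNIV) (\<lambda>(t, x). Dphi t x)
   \<and> continuous_on ({0..T} \<times> UNIV) (\<lambda>(t, x). D2phi t x)"

definition C2 :: "(real^'d \<Rightarrow> real) \<Rightarrow> bool" where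
  "C2 phi \<longleftrightarrow> (\<exists>(Dphi :: real^'d \<Rightarrow> real^'d) (D2phi :: real^'d \<Rightarrow> real^'d^'d).
     (\<forall>x. (phi has_derivative (\<lambda>h. Dphi x \<bullet> h)) (at x)
        \<and> (Dphi has_derivative (\<lambda>h. D2phi x *v h)) (at x))
     \<and> continuous_on UNIV D2phi)"

definition lenv :: "real \<Rightarrow> (nat list \<Rightarrow> real \<Rightarrow> real^'d \<Rightarrow> real) \<Rightarrow> nat list \<Rightarrow> real \<Rightarrow> real^'d \<Rightarrow> ereal" where
  "lenv T u i t x = Liminf (inf (nhds (t, x)) (principal ({0..<T} \<times> UNIV))) (\<lambda>(s, y). ereal (u i s y))"

definition uenv :: "real \<Rightarrow> (nat list \<Rightarrow> real \<Rightarrow> real^'d \<Rightarrow> real) \<Rightarrow> nat list \<Rightarrow> real \<Rightarrow> real^'d \<Rightarrow> ereal" where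
  "uenv T u i t x = Limsup (inf (nhds (t, x)) (principal ({0..<T} \<times> UNIV))) (\<lambda>(s, y). ereal (u i s y))"

definition visc_super ::
  "real \<Rightarrow> (nat \<Rightarrow> real) \<Rightarrow> (real^'d \<Rightarrow> 'a \<Rightarrow> real^'d) \<Rightarrow> (real^'d \<Rightarrow> 'a \<Rightarrow> real^'m^'d)
   \<Rightarrow> (real^'d \<Rightarrow> real \<Rightarrow> 'a \<Rightarrow> real) \<Rightarrow> (real^'d \<Rightarrow> 'a \<Rightarrow> real^'m)
   \<Rightarrow> (nat list \<Rightarrow> real \<Rightarrow> real^'d \<Rightarrow> real) \<Rightarrow> bool" where
  "visc_super T p lam sig lamY sigY u \<longleftrightarrow>
    (\<forall>phi phit Dphi D2phi (phibar :: real \<Rightarrow> real^'d \<Rightarrow> real) i0 t0 x0.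
      (\<forall>i. C12 T (phi i) (phit i) (Dphi i) (D2phi i))
      \<and> continuous_on ({0..T} \<times> UNIV) (\<lambda>(t, x). phibar t x)
      \<and> (\<forall>i. \<forall>t\<in>{0..T}. \<forall>x. \<bar>phi i t x\<bar> \<le> phibar t x)
      \<and> t0 \<in> {0..<T}
      \<and> lenv T u i0 t0 x0 = ereal (phi i0 t0 x0)
      \<and> (\<forall>i. \<forall>t\<in>{0..T}. \<forall>x. ereal (phi i t x) \<le> lenv T u i t x)
      \<longrightarrow> 0 \<le> min (ereal (- phit i0 t0 x0)
                     + Fup lam sig lamY sigY x0 (phi i0 t0 x0) (Dphi i0 t0 x0) (D2phi i0 t0 x0))
                   (ereal (phi i0 t0 x0 - (SUP k\<in>{k. enat k < Kbar p}. phi (i0 @ [k]) t0 x0))))"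

definition visc_sub ::
  "real \<Rightarrow> (nat \<Rightarrow> real) \<Rightarrow> (real^'d \<Rightarrow> 'a \<Rightarrow> real^'d) \<Rightarrow> (real^'d \<Rightarrow> 'a \<Rightarrow> real^'m^'d)
   \<Rightarrow> (real^'d \<Rightarrow> real \<Rightarrow> 'a \<Rightarrow> real) \<Rightarrow> (real^'d \<Rightarrow> 'a \<Rightarrow> real^'m)
   \<Rightarrow> (nat list \<Rightarrow> real \<Rightarrow> real^'d \<Rightarrow> real) \<Rightarrow> bool" where
  "visc_sub T p lam sig lamY sigY u \<longleftrightarrow>
    (\<forall>phi phit Dphi D2phi (phibar :: real \<Rightarrow> real^'d \<Rightarrow> real) i0 t0 x0.
      (\<forall>i. C12 T (phi i) (phit i) (Dphi i) (D2phi i))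
      \<and> continuous_on ({0..T} \<times> UNIV) (\<lambda>(t, x). phibar t x)
      \<and> (\<forall>i. \<forall>t\<in>{0..T}. \<forall>x. \<bar>phi i t x\<bar> \<le> phibar t x)
      \<and> t0 \<in> {0..<T}
      \<and> uenv T u i0 t0 x0 = ereal (phi i0 t0 x0)
      \<and> (\<forall>i. \<forall>t\<in>{0..T}. \<forall>x. uenv T u i t x \<le> ereal (phi i t x))
      \<longrightarrow> min (ereal (- phit i0 t0 x0)
                 + Flow lam sig lamY sigY x0 (phi i0 t0 x0) (Dphi i0 t0 x0) (D2phi i0 t0 x0))
               (ereal (phi i0 t0 x0 - (SUP k\<in>{k. enat k < Kbar p}. phi (i0 @ [k]) t0 x0))) \<le> 0)"

definition term_super ::
  "real \<Rightarrow> (nat \<Rightarrow> real) \<Rightarrow> (nat list \<Rightarrow> real^'d \<Rightarrow> real)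
   \<Rightarrow> (nat list \<Rightarrow> real \<Rightarrow> real^'d \<Rightarrow> real) \<Rightarrow> bool" where
  "term_super T p g u \<longleftrightarrow>
    (\<forall>phi (phibar :: real^'d \<Rightarrow> real) i0 x0.
      (\<forall>i. C2 (phi i)) \<and> continuous_on UNIV phibar \<and> (\<forall>i x. \<bar>phi i x\<bar> \<le> phibar x)
      \<and> u i0 T x0 = phi i0 x0 \<and> (\<forall>i x. phi i x \<le> u i T x)
      \<longrightarrow> 0 \<le> min (phi i0 x0 - g i0 x0)
                   (phi i0 x0 - (SUP k\<in>{k. enat k < Kbar p}. phi (i0 @ [k]) x0)))"

definition term_sub ::
  "real \<Rightarrow> (nat \<Rightarrow> real) \<Rightarrow> (nat list \<Rightarrow> real^'d \<Rightarrow> real)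
   \<Rightarrow> (nat list \<Rightarrow> real \<Rightarrow> real^'d \<Rightarrow> real) \<Rightarrow> bool" where
  "term_sub T p g u \<longleftrightarrow>
    (\<forall>phi (phibar :: real^'d \<Rightarrow> real) i0 x0.
      (\<forall>i. C2 (phi i)) \<and> continuous_on UNIV phibar \<and> (\<forall>i x. \<bar>phi i x\<bar> \<le> phibar x)
      \<and> u i0 T x0 = phi i0 x0 \<and> (\<forall>i x. u i T x \<le> phi i x)
      \<longrightarrow> min (phi i0 x0 - g i0 x0)
               (phi i0 x0 - (SUP k\<in>{k. enat k < Kbar p}. phi (i0 @ [k]) x0)) \<le> 0)"

end

(* The standing assumptions degenerate the equation. By (H3)(iii) every control set N_0(x, q) is
   nonempty, so the linear map q -> sigma(x)^T q takes its values in the bounded set sigma_Y(x, A);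
   hence sigma = 0, the control sets do not depend on the gradient, and the operator is the first-order
   Hamiltonian f(x, y) - lambda(x) . p with f uniformly continuous in x and Lipschitz in y.

   If u exceeds w somewhere, decay in the label and a weight chi(t, x) = exp(kappa (T - t)) (1 + |x|^2)^n
   make the maximum theta of (u - w) / chi attained, and at only finitely many labels. At a longest such
   label i0 the difference of the functions at every child i0 k is strictly smaller, so neither obstacle
   can be active near the maximum, and the classical doubling of variables applies to the single label
   i0: at t = T it compares both functions with g, and at t < T the choice of kappa contradicts the two
   first-order inequalities. In the test families the other labels carry the functions
   u_i(z0) + e + c |z - z0|^2 (1 + |x|^2)^n with one constant c for all labels. *)

theory Submission
  imports Defs
begin

section \<open>Calculus of test functions\<close>

text \<open>With no second-order term, the quadratic penalty itself supplies both test functions,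
  and Hessians occur only existentially.

  The obstacle that shapes the proof is that the inequalities are tested on all labels at once,
  under one continuous bound: contact at one label must be extended to a family on the right side at
  infinitely many labels, and the subsolution inequality says something about the operator only if
  the children stay strictly below. Decay in the label gives the extension, the longest label the
  separation: the supersolution property bounds w at each child by w at the parent, so a gap for u -
  w becomes a gap for u alone.

  Time T needs care, since the terminal conditions use functions of x alone and the interior ones
  only times below T. The doubling therefore runs on the slice t = T if the maximum at i0 is
  attained there, and on the whole strip otherwise, where the doubled points converge to a time
  below T.

  With n the exponent of chi and b the drift, kappa = 4 n (|b(0)| + L) + L + 1: the first term pays
  for the drift acting on chi, L for the dependence on y, and the final 1 leaves delta <= delta / 2
  for the positive maximum delta.\<close>

definition outer :: "real^'d \<Rightarrow> real^'d \<Rightarrow> real^'d^'d" where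
  "outer v w = (\<chi> i j. v $ i * w $ j)"

lemma outer_mult_vec: "outer v w *v h = (w \<bullet> h) *\<^sub>R v"
  by (simp add: outer_def matrix_vector_mult_def inner_vec_def vec_eq_iff sum_distrib_left
      mult.assoc mult.commute mult.left_commute)

lemma continuous_on_outer [continuous_intros]:
  assumes "continuous_on S f" "continuous_on S g"
  shows "continuous_on S (\<lambda>z. outer (f z) (g z))"
  unfolding outer_def using assms by (intro continuous_intros)

lemma C12_const: "C12 T (\<lambda>t x. c) (\<lambda>t x. 0) (\<lambda>t x. 0) (\<lambda>t x. 0)"
  by (auto simp: C12_def case_prod_beta intro!: derivative_eq_intros)

lemma C12_add:
  assumes "C12 T f ft Df D2f" and "C12 T g gt Dg D2g"
  shows "C12 T (\<lambda>t x. f t x + g t x) (\<lambda>t x. ft t x + gt t x)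
           (\<lambda>t x. Df t x + Dg t x) (\<lambda>t x. D2f t x + D2g t x)"
proof -
  have "((\<lambda>z. f t z + g t z) has_derivative (\<lambda>h. (Df t x + Dg t x) \<bullet> h)) (at x)"
    and "((\<lambda>z. Df t z + Dg t z) has_derivative (\<lambda>h. (D2f t x + D2g t x) *v h)) (at x)"
    if "t \<in> {0..T}" for t x
    unfolding inner_add_left matrix_vector_mult_add_rdistrib
    using that assms unfolding C12_def by (auto intro: has_derivative_add)
  then show ?thesis
    using assms unfolding C12_def case_prod_beta
    by (auto intro!: derivative_intros continuous_intros)
qed

text \<open>The Hessian is the termwise derivative of f Dg + g Df; the two rank-one matrices come
  from differentiating the scalar factors.\<close>

lemma C12_mult:
  assumes "C12 T f ft Df D2f" and "C12 T g gt Dg D2g"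
  shows "C12 T (\<lambda>t x. f t x * g t x) (\<lambda>t x. ft t x * g t x + f t x * gt t x)
           (\<lambda>t x. f t x *\<^sub>R Dg t x + g t x *\<^sub>R Df t x)
           (\<lambda>t x. f t x *\<^sub>R D2g t x + outer (Dg t x) (Df t x)
                   + (g t x *\<^sub>R D2f t x + outer (Df t x) (Dg t x)))"
proof -
  have t: "((\<lambda>s. f s x * g s x) has_real_derivative ft t x * g t x + f t x * gt t x) (at t within {0..T})"
    if "t \<in> {0..T}" for t x
    using that assms unfolding C12_def by (auto intro!: derivative_eq_intros)
  have x: "((\<lambda>z. f t z * g t z) has_derivative (\<lambda>h. (f t x *\<^sub>R Dg t x + g t x *\<^sub>R Df t x) \<bullet> h)) (at x)"
    if "t \<in> {0..T}" for t x
  proof -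
    have "((\<lambda>z. f t z * g t z) has_derivative (\<lambda>h. f t x * (Dg t x \<bullet> h) + (Df t x \<bullet> h) * g t x)) (at x)"
      using that assms unfolding C12_def by (auto intro!: has_derivative_mult)
    then show ?thesis by (simp add: inner_add_left mult.commute)
  qed
  have xx: "((\<lambda>z. f t z *\<^sub>R Dg t z + g t z *\<^sub>R Df t z) has_derivative
      (\<lambda>h. (f t x *\<^sub>R D2g t x + outer (Dg t x) (Df t x)
                   + (g t x *\<^sub>R D2f t x + outer (Df t x) (Dg t x))) *v h)) (at x)"
    if "t \<in> {0..T}" for t x
  proof -
    have "((\<lambda>z. f t z *\<^sub>R Dg t z + g t z *\<^sub>R Df t z) has_derivative
      (\<lambda>h. (f t x *\<^sub>R (D2g t x *v h) + (Df t x \<bullet> h) *\<^sub>R Dg t x) +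
           (g t x *\<^sub>R (D2f t x *v h) + (Dg t x \<bullet> h) *\<^sub>R Df t x))) (at x)"
      using that assms unfolding C12_def
      by (intro has_derivative_add has_derivative_scaleR) auto
    then show ?thesis
      by (simp add: matrix_vector_mult_add_rdistrib outer_mult_vec scaleR_matrix_vector_assoc)
  qed
  show ?thesis
    using assms t x xx unfolding C12_def case_prod_beta
    by (auto intro!: continuous_intros)
qed

lemma C12_cmult:
  assumes "C12 T f ft Df D2f"
  shows "C12 T (\<lambda>t x. c * f t x) (\<lambda>t x. c * ft t x) (\<lambda>t x. c *\<^sub>R Df t x) (\<lambda>t x. c *\<^sub>R D2f t x)"
proof -
  have "((\<lambda>z. c * f t z) has_derivative (\<lambda>h. (c *\<^sub>R Df t x) \<bullet> h)) (at x)"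
    and "((\<lambda>z. c *\<^sub>R Df t z) has_derivative (\<lambda>h. (c *\<^sub>R D2f t x) *v h)) (at x)"
    if "t \<in> {0..T}" for t x
    unfolding inner_scaleR_left scaleR_matrix_vector_assoc[symmetric]
    using that assms unfolding C12_def
    by (auto intro: has_derivative_mult_right has_derivative_scaleR_right)
  then show ?thesis
    using assms unfolding C12_def case_prod_beta
    by (auto intro!: derivative_eq_intros continuous_intros)
qed

lemma C12_time:
  assumes "\<And>t. t \<in> {0..T} \<Longrightarrow> (f has_real_derivative f' t) (at t within {0..T})"
    and "continuous_on {0..T} f'"
  shows "C12 T (\<lambda>t x. f t) (\<lambda>t x. f' t) (\<lambda>t x. 0) (\<lambda>t x. 0)"
proof -
  have "continuous_on {0..T} f"
    by (rule DERIV_continuous_on) (rule assms(1))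
  then have "continuous_on ({0..T} \<times> UNIV) (\<lambda>z::real \<times> (real^'d). f (fst z))"
    by (rule continuous_on_compose2) (auto intro!: continuous_intros)
  moreover have "continuous_on ({0..T} \<times> UNIV) (\<lambda>z::real \<times> (real^'d). f' (fst z))"
    by (rule continuous_on_compose2[OF assms(2)]) (auto intro!: continuous_intros)
  ultimately show ?thesis
    using assms by (auto simp: C12_def case_prod_beta)
qed

lemma C12_norm_sq:
  "C12 T (\<lambda>t x. (norm (x - x0))\<^sup>2) (\<lambda>t x. 0) (\<lambda>t x. 2 *\<^sub>R (x - x0)) (\<lambda>t x. 2 *\<^sub>R mat 1)"
proof -
  have "((\<lambda>z. (norm (z - x0))\<^sup>2) has_derivative (\<lambda>h. (2 *\<^sub>R (x - x0)) \<bullet> h)) (at x)" for x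
    unfolding power2_norm_eq_inner
    by (auto intro!: derivative_eq_intros simp: inner_commute)
  moreover have "((\<lambda>z. 2 *\<^sub>R (z - x0)) has_derivative (\<lambda>h. (2 *\<^sub>R mat 1) *v h)) (at x)" for x
    by (auto intro!: derivative_eq_intros simp: scaleR_matrix_vector_assoc[symmetric])
  ultimately show ?thesis
    by (auto simp: C12_def case_prod_beta intro!: continuous_intros)
qed

text \<open>A smooth replacement for 1 + |x|^q. Raising the exponent by one multiplies by the
  unbounded factor 1 + |x|^2, which is how a weight of exponent \<open>Suc m\<close> beats growth of
  exponent \<open>m\<close>.\<close>

definition wt :: "nat \<Rightarrow> real^'d \<Rightarrow> real" where
  "wt n x = (1 + (norm x)\<^sup>2) ^ n"

lemma wt_ge_1: "1 \<le> wt n x"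
  by (simp add: wt_def)

text \<open>The Hessian stays existential because it meets the equation only through sigma sigma^T,
  which vanishes. At \<open>n = 0\<close> the truncated \<open>n - 1\<close> is harmless: the factor
  \<open>n\<close> is zero.\<close>

lemma C12_wt:
  fixes n :: nat
  shows "\<exists>D2. C12 T (\<lambda>t (x::real^'d). wt n x) (\<lambda>t x. 0) (\<lambda>t x. (2 * real n * wt (n - 1) x) *\<^sub>R x) D2"
proof (induction n)
  case 0
  then show ?case using C12_const[of T 1] by (auto simp: wt_def)
next
  case (Suc n)
  then obtain D2 where D2: "C12 T (\<lambda>t (x::real^'d). wt n x) (\<lambda>t x. 0) (\<lambda>t x. (2 * real n * wt (n - 1) x) *\<^sub>R x) D2"
    by blast
  have 1: "C12 T (\<lambda>t (x::real^'d). 1 + (norm (x - 0))\<^sup>2) (\<lambda>t x. 0 + 0) (\<lambda>t x. 0 + 2 *\<^sub>R (x - 0)) (\<lambda>t x. 0 + 2 *\<^sub>R mat 1)"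
    by (rule C12_add[OF C12_const C12_norm_sq])
  have *: "(1 + (norm x)\<^sup>2) * (2 * real n * wt (n - 1) x) + 2 * wt n x = 2 * real (Suc n) * wt n x" for x :: "real^'d"
    by (cases n) (auto simp: wt_def algebra_simps)
  have "(1 + (norm x)\<^sup>2) *\<^sub>R ((2 * real n * wt (n - 1) x) *\<^sub>R x) + wt n x *\<^sub>R (2 *\<^sub>R x)
      = (2 * real (Suc n) * wt n x) *\<^sub>R x" for x :: "real^'d"
    using *[of x] by (simp flip: scaleR_add_left add: mult.commute)
  with C12_mult[OF 1 D2] show ?case
    by (auto simp: wt_def simp del: of_nat_Suc)
qed

text \<open>Lets the families built for the interior equation serve, sliced at t = T, as test data
  for the terminal condition.\<close>

lemma C12_imp_C2:
  assumes "C12 T f ft Df D2f" and "t \<in> {0..T}"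
  shows "C2 (f t)"
proof -
  have "continuous_on UNIV (\<lambda>x. D2f t x)"
    using assms(1) unfolding C12_def case_prod_beta
    by (intro continuous_on_compose2[of "{0..T} \<times> UNIV" "\<lambda>z. D2f (fst z) (snd z)" UNIV "\<lambda>x. (t, x)", simplified])
       (use assms(2) in \<open>auto intro!: continuous_intros\<close>)
  then show ?thesis
    using assms unfolding C12_def C2_def by (intro exI[of _ "Df t"] exI[of _ "D2f t"]) auto
qed

section \<open>The degenerate operator\<close>

text \<open>The infimum in \<open>dH\<close> need not be attained; a strict bound leaves room for an
  admissible radius below \<open>r\<close>.\<close>

lemma dH_lessD:
  assumes "dH B C < ereal r" and "b \<in> B"
  shows "\<exists>c\<in>C. dist b c \<le> r"
proof -
  from assms(1) have "Inf {ereal r | r. r \<ge> 0 \<and> B \<subseteq> thick C r \<and> C \<subseteq> thick B r} < ereal r"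
    by (auto simp: dH_def split: if_splits)
  then obtain r' where "r' < r" "B \<subseteq> thick C r'"
    unfolding Inf_less_iff by auto
  then obtain c where "c \<in> C" "dist b c \<le> r'"
    using assms(2) by (auto simp: thick_def)
  with \<open>r' < r\<close> show ?thesis by force
qed

text \<open>\<open>dH\<close> is infinite as soon as one set is empty, so the mere finiteness of the
  bound in (H3)(iii) makes every control set nonempty.\<close>

lemma dH_finite_imp_nonempty:
  assumes "dH B C \<le> ereal r"
  shows "B \<noteq> {}" and "C \<noteq> {}"
  using assms by (auto simp: dH_def split: if_splits)

text \<open>Since every control set \<open>N\<^sub>0(x, q)\<close> is nonempty, every vector \<open>\<sigma>(x)\<^sup>T q\<close> is a value of
  the bounded function \<open>\<sigma>\<^sub>Y(x, \<cdot>)\<close>; a bounded linear map vanishes.\<close>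

lemma volatility_zero:
  fixes sig :: "real^'d \<Rightarrow> 'a \<Rightarrow> real^'m^'d"
  assumes indep: "\<And>a a'. sig x a = sig x a'"
    and bd: "\<And>a. norm (sigY x a) \<le> B"
    and ne: "\<And>q. Nset sig sigY 0 x q \<noteq> {}"
  shows "sig x a = 0"
proof -
  have bound: "norm (transpose (sig x a) *v q) \<le> B" for q
  proof -
    from ne[of q] obtain a' where "sigY x a' = transpose (sig x a') *v q"
      by (auto simp: Nset_def Nop_def)
    with bd[of a'] indep[of a' a] show ?thesis by simp
  qed
  have "transpose (sig x a) *v q = 0" for q
  proof (rule ccontr)
    assume nz: "transpose (sig x a) *v q \<noteq> 0"
    let ?v = "transpose (sig x a) *v q"
    \<comment> \<open>Scaling \<open>q\<close> scales its image, so a large multiple of a nonzero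
      image leaves the ball of radius \<open>B\<close>.\<close>
    obtain k where k: "B < k * norm ?v" using reals_Archimedean3[of "norm ?v"] nz by auto
    have "transpose (sig x a) *v (\<bar>k\<bar> *\<^sub>R q) = \<bar>k\<bar> *\<^sub>R ?v"
      by (simp add: matrix_vector_mult_scaleR)
    then have "\<bar>k\<bar> * norm ?v \<le> B"
      using bound[of "\<bar>k\<bar> *\<^sub>R q"] by simp
    moreover have "k * norm ?v \<le> \<bar>k\<bar> * norm ?v"
      by (intro mult_right_mono) auto
    ultimately show False using k by linarith
  qed
  then have "transpose (sig x a) = 0"
    by (metis matrix_eq matrix_vector_mult_0)
  then have "transpose (transpose (sig x a)) = transpose 0" by simp
  then show ?thesis by (simp add: transpose_def vec_eq_iff)
qed

text \<open>What the assumptions become once the volatility vanishes. Control sets are taken at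
  gradient 0, as they no longer depend on it; \<open>lamY_mod\<close> combines the modulus
  \<open>w\<close> with its monotonicity; \<open>N_near\<close> is (H3)(iii) read pointwise, for
  every radius above the Hausdorff bound.\<close>

locale drift_control =
  fixes lam :: "real^'d \<Rightarrow> 'a::metric_space \<Rightarrow> real^'d"
    and sig :: "real^'d \<Rightarrow> 'a \<Rightarrow> real^'m^'d"
    and lamY :: "real^'d \<Rightarrow> real \<Rightarrow> 'a \<Rightarrow> real"
    and sigY :: "real^'d \<Rightarrow> 'a \<Rightarrow> real^'m"
    and b :: "real^'d \<Rightarrow> real^'d" and w :: "real \<Rightarrow> real" and B C L :: real
  assumes lam_eq: "lam x a = b x" and sig_eq: "sig x a = 0"
    and lamY_bound: "\<bar>lamY 0 0 a\<bar> \<le> B"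
    and L_nonneg: "0 \<le> L"
    and b_lip: "norm (b x - b x') \<le> L * norm (x - x')"
    and lamY_lip: "\<bar>lamY x y a - lamY x' y' a\<bar> \<le> L * (norm (x - x') + \<bar>y - y'\<bar>)"
    and lamY_mod: "dist a a' \<le> r \<Longrightarrow> \<bar>lamY x y a - lamY x y a'\<bar> \<le> w r"
    and w_lim: "(w \<longlongrightarrow> 0) (at_right 0)"
    and C_pos: "0 < C"
    and N_nonempty: "Nset sig sigY 0 x 0 \<noteq> {}"
    and N_near: "\<lbrakk>0 \<le> eps; 0 \<le> eps'; C * (eps + eps') * (1 + norm x) + C * norm (x - x') < r;
         a \<in> Nset sig sigY eps x 0\<rbrakk> \<Longrightarrow> \<exists>a'\<in>Nset sig sigY eps' x' 0. dist a a' \<le> r"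
begin

definition f :: "real^'d \<Rightarrow> real \<Rightarrow> real" where
  "f x y = (SUP a\<in>Nset sig sigY 0 x 0. lamY x y a)"

lemma w_small: "0 < e \<Longrightarrow> \<exists>r>0. w r < e"
proof -
  assume "0 < e"
  from order_tendstoD(2)[OF w_lim this] obtain c where "c > 0" "\<And>y. 0 < y \<Longrightarrow> y < c \<Longrightarrow> w y < e"
    unfolding eventually_at_right_field by auto
  then show ?thesis by (intro exI[of _ "c / 2"]) auto
qed

lemma lamY_bdd_above: "bdd_above (lamY x y ` Nset sig sigY 0 x 0)"
proof (rule bdd_aboveI)
  fix v assume "v \<in> lamY x y ` Nset sig sigY 0 x 0"
  then obtain a where "v = lamY x y a" by auto
  then show "v \<le> B + L * (norm x + \<bar>y\<bar>)"
    using lamY_bound[of a] lamY_lip[of x y a 0 0] by simp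
qed

lemma Nset_eq: "Nset sig sigY eps x q = Nset sig sigY eps x 0"
  by (simp add: Nset_def Nop_def sig_eq transpose_def zero_vec_def[symmetric])

lemma Feps_eq:
  "Feps lam sig lamY sigY eps x y q M = (SUP a\<in>Nset sig sigY eps x 0. ereal (lamY x y a - b x \<bullet> q))"
proof -
  have "trace (sig x a ** transpose (sig x a) ** M) = 0" for a
    by (simp add: sig_eq trace_def matrix_matrix_mult_def)
  then show ?thesis
    unfolding Feps_def lam_eq by (subst Nset_eq) simp
qed

lemma lamY_transfer:
  assumes "dist a a' \<le> r"
  shows "lamY x' y' a' \<le> lamY x y a + w r + L * (norm (x' - x) + \<bar>y' - y\<bar>)"
  using lamY_mod[OF assms, of x y] lamY_lip[of x' y' a' x y] by linarith

text \<open>Every control admissible at \<open>x'\<close> has a neighbour within \<open>r\<close>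
  admissible at \<open>x\<close>, so the supremum at \<open>x'\<close> gains at most the moduli of
  \<open>lamY\<close>.\<close>

lemma f_modulus:
  assumes "C * norm (x - x') < r"
  shows "f x' y' \<le> f x y + w r + L * (norm (x' - x) + \<bar>y' - y\<bar>)"
  unfolding f_def[of x' y']
proof (rule cSUP_least[OF N_nonempty])
  fix a' assume "a' \<in> Nset sig sigY 0 x' 0"
  then obtain a where a: "a \<in> Nset sig sigY 0 x 0" "dist a' a \<le> r"
    using N_near[of 0 0 x' x r a'] assms by (auto simp: norm_minus_commute)
  have "lamY x y a \<le> f x y"
    unfolding f_def by (rule cSUP_upper[OF a(1) lamY_bdd_above])
  with lamY_transfer[of a a' r x' y' x y] a(2)
  show "lamY x' y' a' \<le> f x y + w r + L * (norm (x' - x) + \<bar>y' - y\<bar>)"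
    by (simp add: dist_commute)
qed

text \<open>For eps = eps' = 0 the factor 1 + |x| disappears from (H3)(iii), so the modulus in x is
  uniform on the whole space.\<close>

lemma f_uniform:
  assumes "0 < e"
  shows "\<exists>d>0. \<forall>x x' y y'. norm (x - x') < d \<longrightarrow> f x' y' \<le> f x y + e + L * \<bar>y' - y\<bar>"
proof -
  obtain r where r: "r > 0" "w r < e / 2" using w_small[of "e / 2"] assms by auto
  \<comment> \<open>The first entry keeps the Hausdorff bound below \<open>r\<close>, the second
    keeps the Lipschitz term below \<open>e / 2\<close>; \<open>L + 1\<close> avoids dividing by
    zero.\<close>
  define d where "d = min (r / C) (e / (2 * (L + 1)))"
  have "d > 0" using r C_pos assms L_nonneg by (simp add: d_def)
  moreover have "f x' y' \<le> f x y + e + L * \<bar>y' - y\<bar>" if "norm (x - x') < d" for x x' y y'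
  proof -
    have "C * norm (x - x') < r" and le: "norm (x - x') \<le> e / (2 * (L + 1))"
      using that C_pos by (auto simp: d_def field_simps)
    from f_modulus[OF this(1), of y' y]
    have 1: "f x' y' \<le> f x y + w r + L * (norm (x' - x) + \<bar>y' - y\<bar>)" .
    have "L * norm (x' - x) \<le> (L + 1) * (e / (2 * (L + 1)))"
      using le L_nonneg by (intro mult_mono) (auto simp: norm_minus_commute)
    also have "\<dots> = e / 2" using L_nonneg by (simp add: field_simps)
    finally show ?thesis using 1 r(2) by (simp add: distrib_left)
  qed
  ultimately show ?thesis by blast
qed

lemma isCont_b: "isCont b x"
proof -
  have "L-lipschitz_on UNIV b"
    using b_lip L_nonneg by (auto simp: lipschitz_on_def dist_norm)
  then show ?thesis
    using lipschitz_on_continuous_on continuous_on_eq_continuous_at open_UNIV by blast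
qed

text \<open>One neighbourhood for both relaxed operators: the bound in the first line controls the
  distance from N_eps(x') to N_0(x), the second the Lipschitz and drift terms. Both vanish at the
  base point and are continuous there.\<close>

lemma eventually_near:
  fixes x q :: "real^'d" and y :: real and M :: "real^'d^'d"
  assumes "0 < e"
  shows "\<forall>\<^sub>F z in at (0, (x, y, q, M)) within ({0<..} \<times> UNIV).
    case z of (eps, (x', y', q', M')) \<Rightarrow>
      0 < eps \<and> C * eps * (1 + norm x') + C * norm (x - x') < e
      \<and> L * (norm (x' - x) + \<bar>y' - y\<bar>) + \<bar>b x' \<bullet> q' - b x \<bullet> q\<bar> < e"
    (is "eventually _ ?F")
proof -
  have lim: "((\<lambda>z. z) \<longlongrightarrow> (0, (x, y, q, M))) ?F" by (rule tendsto_ident_at)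
  note fs = tendsto_fst[OF lim] tendsto_snd[OF lim]
  note x' = tendsto_fst[OF fs(2)] and s2 = tendsto_snd[OF fs(2)]
  note y' = tendsto_fst[OF s2] and q' = tendsto_fst[OF tendsto_snd[OF s2]]
  note b' = isCont_tendsto_compose[OF isCont_b x']
  have "((\<lambda>z. C * fst z * (1 + norm (fst (snd z))) + C * norm (x - fst (snd z)))
      \<longlongrightarrow> C * 0 * (1 + norm x) + C * norm (x - x)) ?F"
    using fs(1) x' by (intro tendsto_intros) auto
  then have 1: "\<forall>\<^sub>F z in ?F. C * fst z * (1 + norm (fst (snd z))) + C * norm (x - fst (snd z)) < e"
    using assms by (intro order_tendstoD(2)) auto
  have "((\<lambda>z. L * (norm (fst (snd z) - x) + \<bar>fst (snd (snd z)) - y\<bar>)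
        + \<bar>b (fst (snd z)) \<bullet> fst (snd (snd (snd z))) - b x \<bullet> q\<bar>)
      \<longlongrightarrow> L * (norm (x - x) + \<bar>y - y\<bar>) + \<bar>b x \<bullet> q - b x \<bullet> q\<bar>) ?F"
    using b' x' y' q' by (intro tendsto_intros) auto
  then have 2: "\<forall>\<^sub>F z in ?F. L * (norm (fst (snd z) - x) + \<bar>fst (snd (snd z)) - y\<bar>)
        + \<bar>b (fst (snd z)) \<bullet> fst (snd (snd (snd z))) - b x \<bullet> q\<bar> < e"
    using assms by (intro order_tendstoD(2)) auto
  have 3: "\<forall>\<^sub>F z in ?F. 0 < fst z"
    by (auto simp: eventually_at_filter intro: always_eventually)
  show ?thesis
    using 1 2 3 by eventually_elim auto
qed

text \<open>Relaxing the constraint costs nothing in the limit, since controls of N_eps(x') lie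
  close to N_0(x). The supersolution inequality bounds \<open>Fup\<close> from below, so this turns
  it into an inequality for \<open>f\<close>; \<open>Flow_ge\<close> does the same for
  subsolutions.\<close>

lemma Fup_le: "Fup lam sig lamY sigY x y q M \<le> ereal (f x y - b x \<bullet> q)"
proof (rule ereal_le_epsilon2)
  fix e :: real assume "0 < e"
  then obtain r where r: "r > 0" "w r < e / 2" using w_small[of "e / 2"] by auto
  have "Fup lam sig lamY sigY x y q M \<le> ereal (f x y - b x \<bullet> q + e)"
    unfolding Fup_def
  proof (rule Limsup_bounded)
    show "\<forall>\<^sub>F z in at (0, (x, y, q, M)) within ({0<..} \<times> UNIV).
       (case z of (eps, (x', y', q', M')) \<Rightarrow> Feps lam sig lamY sigY eps x' y' q' M')
         \<le> ereal (f x y - b x \<bullet> q + e)"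
      using eventually_near[of "min r (e / 2)" x y q M]
    proof (rule eventually_mono)
      show "0 < min r (e / 2)" using r \<open>0 < e\<close> by simp
    next
      fix z :: "real \<times> (real^'d) \<times> real \<times> (real^'d) \<times> (real^'d^'d)"
      assume z: "case z of (eps, (x', y', q', M')) \<Rightarrow>
        0 < eps \<and> C * eps * (1 + norm x') + C * norm (x - x') < min r (e / 2)
        \<and> L * (norm (x' - x) + \<bar>y' - y\<bar>) + \<bar>b x' \<bullet> q' - b x \<bullet> q\<bar> < min r (e / 2)"
      obtain eps x' y' q' M' where zz: "z = (eps, (x', y', q', M'))" by (metis prod.exhaust)
      have "ereal (lamY x' y' a - b x' \<bullet> q') \<le> ereal (f x y - b x \<bullet> q + e)"
        if a: "a \<in> Nset sig sigY eps x' 0" for a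
      proof -
        obtain a' where a': "a' \<in> Nset sig sigY 0 x 0" "dist a a' \<le> r"
          using N_near[of eps 0 x' x r a] a z zz by (auto simp: norm_minus_commute)
        have "lamY x y a' \<le> f x y"
          unfolding f_def by (rule cSUP_upper[OF a'(1) lamY_bdd_above])
        moreover have "lamY x' y' a \<le> lamY x y a' + w r + L * (norm (x' - x) + \<bar>y' - y\<bar>)"
          using lamY_transfer[of a' a r x' y' x y] a'(2) by (simp add: dist_commute)
        moreover have "L * (norm (x' - x) + \<bar>y' - y\<bar>) + \<bar>b x' \<bullet> q' - b x \<bullet> q\<bar> < e / 2"
          using z zz by simp
        ultimately have "lamY x' y' a - b x' \<bullet> q' \<le> f x y - b x \<bullet> q + e"
          using r(2) by (auto simp: abs_real_def split: if_splits)
        then show ?thesis by simp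
      qed
      then show "(case z of (eps, (x', y', q', M')) \<Rightarrow> Feps lam sig lamY sigY eps x' y' q' M')
         \<le> ereal (f x y - b x \<bullet> q + e)"
        unfolding zz by (simp add: Feps_eq SUP_least)
    qed
  qed
  then show "Fup lam sig lamY sigY x y q M \<le> ereal (f x y - b x \<bullet> q) + ereal e" by simp
qed

text \<open>N_0(x') is contained in N_eps(x'), so \<open>Feps\<close> is at least the unrelaxed
  Hamiltonian at x', and the modulus of \<open>f\<close> moves it back to x.\<close>

lemma Flow_ge: "ereal (f x y - b x \<bullet> q) \<le> Flow lam sig lamY sigY x y q M"
proof (rule ereal_le_epsilon2)
  fix e :: real assume "0 < e"
  then obtain r where r: "r > 0" "w r < e / 2" using w_small[of "e / 2"] by auto
  have "ereal (f x y - b x \<bullet> q - e) \<le> Flow lam sig lamY sigY x y q M"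
    unfolding Flow_def
  proof (rule Liminf_bounded)
    show "\<forall>\<^sub>F z in at (0, (x, y, q, M)) within ({0<..} \<times> UNIV).
       ereal (f x y - b x \<bullet> q - e) \<le>
       (case z of (eps, (x', y', q', M')) \<Rightarrow> Feps lam sig lamY sigY eps x' y' q' M')"
      using eventually_near[of "min r (e / 2)" x y q M]
    proof (rule eventually_mono)
      show "0 < min r (e / 2)" using r \<open>0 < e\<close> by simp
    next
      fix z :: "real \<times> (real^'d) \<times> real \<times> (real^'d) \<times> (real^'d^'d)"
      assume z: "case z of (eps, (x', y', q', M')) \<Rightarrow>
        0 < eps \<and> C * eps * (1 + norm x') + C * norm (x - x') < min r (e / 2)
        \<and> L * (norm (x' - x) + \<bar>y' - y\<bar>) + \<bar>b x' \<bullet> q' - b x \<bullet> q\<bar> < min r (e / 2)"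
      obtain eps x' y' q' M' where zz: "z = (eps, (x', y', q', M'))" by (metis prod.exhaust)
      let ?F = "Feps lam sig lamY sigY eps x' y' q' M'"
      have lb: "f x y - b x \<bullet> q - e \<le> f x' y' - b x' \<bullet> q'"
      proof -
        have "C * eps * (1 + norm x') \<ge> 0" using C_pos z zz by auto
        then have "C * norm (x' - x) < r" using z zz by (auto simp: norm_minus_commute)
        from f_modulus[OF this, of y y']
        have "f x y \<le> f x' y' + w r + L * (norm (x' - x) + \<bar>y' - y\<bar>)"
          by (simp add: norm_minus_commute abs_minus_commute)
        moreover have "L * (norm (x' - x) + \<bar>y' - y\<bar>) + \<bar>b x' \<bullet> q' - b x \<bullet> q\<bar> < e / 2"
          using z zz by simp
        ultimately show ?thesis
          using r(2) by (auto simp: abs_real_def split: if_splits)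
      qed
      have "ereal (lamY x' y' a - b x' \<bullet> q') \<le> ?F" if "a \<in> Nset sig sigY 0 x' 0" for a
        using that z zz unfolding Feps_eq by (intro SUP_upper) (auto simp: Nset_def)
      \<comment> \<open>\<open>f\<close> is a real supremum and \<open>?F\<close> an extended one,
        hence the cases on \<open>?F\<close>; minus infinity is excluded because N_0(x') is
        nonempty.\<close>
      then have "ereal (f x' y' - b x' \<bullet> q') \<le> ?F"
      proof (cases ?F)
        case (real v)
        have "f x' y' \<le> v + b x' \<bullet> q'"
          unfolding f_def
        proof (rule cSUP_least[OF N_nonempty])
          fix a assume "a \<in> Nset sig sigY 0 x' 0"
          with \<open>\<And>a. a \<in> Nset sig sigY 0 x' 0 \<Longrightarrow> ereal (lamY x' y' a - b x' \<bullet> q') \<le> ?F\<close>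
          have "ereal (lamY x' y' a - b x' \<bullet> q') \<le> ?F" by blast
          then show "lamY x' y' a \<le> v + b x' \<bullet> q'" using real by simp
        qed
        then show ?thesis using real by simp
      next
        case MInf
        obtain a where "a \<in> Nset sig sigY 0 x' 0" using N_nonempty by blast
        with \<open>\<And>a. a \<in> Nset sig sigY 0 x' 0 \<Longrightarrow> ereal (lamY x' y' a - b x' \<bullet> q') \<le> ?F\<close> MInf
        have False by force
        then show ?thesis ..
      qed simp
      then show "ereal (f x y - b x \<bullet> q - e) \<le>
          (case z of (eps, (x', y', q', M')) \<Rightarrow> Feps lam sig lamY sigY eps x' y' q' M')"
        using lb unfolding zz by (auto intro: order_trans[of _ "ereal (f x' y' - b x' \<bullet> q')"])
    qed
  qed
  then show "ereal (f x y - b x \<bullet> q) \<le> Flow lam sig lamY sigY x y q M + ereal e"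
    by (cases "Flow lam sig lamY sigY x y q M") auto
qed

end

section \<open>Semicontinuous families and touching\<close>

lemma usc_on_subset: "usc_on S f \<Longrightarrow> S' \<subseteq> S \<Longrightarrow> usc_on S' f"
  unfolding usc_on_def using filter_leD[OF at_le[of S' S]] by blast

lemma usc_on_uminus: "lsc_on S f \<Longrightarrow> usc_on S (\<lambda>z. - f z)"
  unfolding usc_on_def lsc_on_def
proof (intro ballI allI impI)
  fix z c
  assume "\<forall>z\<in>S. \<forall>c. c < f z \<longrightarrow> (\<forall>\<^sub>F y in at z within S. c < f y)" "z \<in> S" "- f z < c"
  then have "\<forall>\<^sub>F y in at z within S. - c < f y" by (simp add: minus_less_iff)
  then show "\<forall>\<^sub>F y in at z within S. - f y < c" by eventually_elim simp
qed

lemma usc_on_add: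
  assumes "usc_on S f" and "usc_on S g"
  shows "usc_on S (\<lambda>z. f z + g z)"
  unfolding usc_on_def
proof (intro ballI allI impI)
  fix z c assume z: "z \<in> S" and c: "f z + g z < c"
  let ?d = "(c - f z - g z) / 2"
  have "\<forall>\<^sub>F y in at z within S. f y < f z + ?d" "\<forall>\<^sub>F y in at z within S. g y < g z + ?d"
    using assms z c unfolding usc_on_def by auto
  then show "\<forall>\<^sub>F y in at z within S. f y + g y < c"
  proof eventually_elim
    case (elim y)
    then show ?case by (simp add: field_simps)
  qed
qed

lemma continuous_imp_usc_on:
  assumes "continuous_on S f"
  shows "usc_on S (f :: _ \<Rightarrow> real)"
  using assms by (auto simp: usc_on_def continuous_on_def intro: order_tendstoD(2))

lemma usc_on_nhds:
  assumes "usc_on S f" "z \<in> S" "f z < c"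
  shows "\<forall>\<^sub>F y in nhds z. y \<in> S \<longrightarrow> f y < c"
proof -
  have "\<forall>\<^sub>F y in nhds z. y \<noteq> z \<longrightarrow> y \<in> S \<longrightarrow> f y < c"
    using assms by (auto simp: usc_on_def eventually_at_filter)
  then show ?thesis by eventually_elim (use assms(3) in auto)
qed

lemma usc_on_eventually_seq:
  assumes "usc_on S f" "z \<in> S" "X \<longlonglongrightarrow> z" "\<And>n. X n \<in> S" "f z < c"
  shows "\<forall>\<^sub>F n in sequentially. f (X n) < c"
  using eventually_compose_filterlim[OF usc_on_nhds[OF assms(1,2,5)] assms(3)] assms(4) by simp

text \<open>If no maximum were attained, the relatively open sets {f < f v} would cover K; but among
  finitely many of them the one with the largest level has its own v uncovered.\<close>

lemma usc_on_attains_max: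
  fixes f :: "'z::metric_space \<Rightarrow> real"
  assumes "compact K" "K \<noteq> {}" "usc_on K f"
  shows "\<exists>z\<in>K. \<forall>y\<in>K. f y \<le> f z"
proof (rule ccontr)
  assume neg: "\<not> ?thesis"
  have op: "openin (top_of_set K) {y \<in> K. f y < c}" for c
    unfolding openin_euclidean_subtopology_iff
  proof (intro conjI ballI)
    fix z assume z: "z \<in> {y \<in> K. f y < c}"
    then have "\<forall>\<^sub>F y in at z within K. f y < c"
      using assms(3) by (simp add: usc_on_def)
    then obtain d where "d > 0" "\<forall>y\<in>K. y \<noteq> z \<and> dist y z < d \<longrightarrow> f y < c"
      unfolding eventually_at by blast
    with z show "\<exists>e>0. \<forall>y\<in>K. dist y z < e \<longrightarrow> y \<in> {y \<in> K. f y < c}"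
      by (intro exI[of _ d]) auto
  qed simp
  have "\<forall>c\<in>(\<lambda>v. {y \<in> K. f y < f v}) ` K. openin (top_of_set K) c"
    using op by simp
  moreover have "K \<subseteq> \<Union>((\<lambda>v. {y \<in> K. f y < f v}) ` K)"
  proof
    fix z assume "z \<in> K"
    have "\<not> (\<forall>y\<in>K. f y \<le> f z)" using neg \<open>z \<in> K\<close> by simp
    then obtain y where "y \<in> K" "f z < f y" by (auto simp: not_le)
    with \<open>z \<in> K\<close> show "z \<in> \<Union>((\<lambda>v. {y \<in> K. f y < f v}) ` K)"
      by (intro UN_I[of y]) auto
  qed
  ultimately have "\<exists>D\<subseteq>(\<lambda>v. {y \<in> K. f y < f v}) ` K. finite D \<and> K \<subseteq> \<Union>D"
    using assms(1)[unfolded compact_eq_openin_cover, rule_format, of "(\<lambda>v. {y \<in> K. f y < f v}) ` K"]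
    by simp
  then obtain D where D: "D \<subseteq> (\<lambda>v. {y \<in> K. f y < f v}) ` K" "finite D" "K \<subseteq> \<Union>D"
    by blast
  from finite_subset_image[OF D(2,1)]
  obtain F where F: "F \<subseteq> K" "finite F" "D = (\<lambda>v. {y \<in> K. f y < f v}) ` F" by blast
  have "F \<noteq> {}" using F D assms(2) by auto
  then have "Max (f ` F) \<in> f ` F" using F by (intro Max_in) auto
  then obtain v where v: "v \<in> F" "f v = Max (f ` F)" by auto
  have "v \<in> \<Union>D" using v(1) F(1) D(3) by blast
  then obtain v' where "v' \<in> F" "f v < f v'" unfolding F(3) by blast
  then have "f v' \<le> Max (f ` F)" using F by (intro Max_ge) auto
  then show False using v(2) \<open>f v < f v'\<close> by linarith
qed

text \<open>A letter l weighs l + 1, so a bound on the weight bounds both the letters and, through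
  the summand 1, the length.\<close>

lemma finite_wlen_less: "finite {i. wlen i < N}"
proof (rule finite_subset)
  have len: "length i \<le> wlen i" and el: "l \<in> set i \<Longrightarrow> l < wlen i" for i l
    by (induction i) (auto simp: wlen_def)
  show "{i. wlen i < N} \<subseteq> {i. set i \<subseteq> {..<N} \<and> length i \<le> N}"
  proof
    fix i assume "i \<in> {i. wlen i < N}"
    then have "wlen i < N" by simp
    moreover have "l < N" if "l \<in> set i" for l
      using el[OF that] \<open>wlen i < N\<close> by simp
    ultimately show "i \<in> {i. set i \<subseteq> {..<N} \<and> length i \<le> N}"
      using len[of i] by auto
  qed
  show "finite {i. set i \<subseteq> {..<N::nat} \<and> length i \<le> N}"
    by (rule finite_lists_length_le) simp
qed

text \<open>Makes the set of children nonempty; a real-valued supremum over the empty set would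
  carry no information.\<close>

lemma Kbar_pos:
  assumes "p sums (1::real)" and "\<And>k. 0 \<le> p k"
  shows "enat 0 < Kbar p"
proof -
  have "\<exists>k. p k > 0"
  proof (rule ccontr)
    assume "\<nexists>k. p k > 0"
    then have "p = (\<lambda>k. 0)" using assms(2) by (metis antisym not_le ext)
    with assms(1) have "(\<lambda>k. 0::real) sums 1" by simp
    then show False using sums_unique2[OF sums_zero] by force
  qed
  then show ?thesis
    unfolding Kbar_def by (auto simp: less_Sup_iff)
qed

text \<open>One constant serves all labels: by decay only finitely many labels are not already below the
  level \<open>e\<close>.\<close>

lemma uniform_majorant:
  fixes U :: "nat list \<Rightarrow> real \<times> (real^'d) \<Rightarrow> real"
  assumes usc: "\<And>i. usc_on S (U i)" and z0: "z0 \<in> S" and e: "0 < e"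
    and growth: "\<And>i z. z \<in> S \<Longrightarrow> \<bar>U i z\<bar> \<le> M * wt n (snd z)"
    and decay: "\<And>e. 0 < e \<Longrightarrow> \<exists>N. \<forall>i. N \<le> wlen i \<longrightarrow> (\<forall>z\<in>S. \<bar>U i z\<bar> \<le> e)"
  shows "\<exists>c\<ge>0. \<forall>i. \<forall>z\<in>S. U i z \<le> U i z0 + e + c * ((dist z z0)\<^sup>2 * wt n (snd z))"
proof -
  obtain N where N: "\<And>i z. N \<le> wlen i \<Longrightarrow> z \<in> S \<Longrightarrow> \<bar>U i z\<bar> \<le> e / 2"
    using decay[of "e / 2"] e by auto
  have M: "0 \<le> M"
  proof (rule ccontr)
    assume "\<not> 0 \<le> M"
    then have "M * wt n (snd z0) < 0"
      using wt_ge_1[of n "snd z0"] by (intro mult_neg_pos) auto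
    with growth[OF z0, of "[]"] show False by linarith
  qed
  have "\<exists>c\<ge>0. \<forall>z\<in>S. U i z \<le> U i z0 + e + c * ((dist z z0)\<^sup>2 * wt n (snd z))" for i
  proof -
    have "\<forall>\<^sub>F z in at z0 within S. U i z < U i z0 + e"
      using usc[of i] z0 e by (auto simp: usc_on_def)
    then obtain d where d: "d > 0" "\<And>z. z \<in> S \<Longrightarrow> z \<noteq> z0 \<Longrightarrow> dist z z0 < d \<Longrightarrow> U i z < U i z0 + e"
      unfolding eventually_at by (auto simp: dist_commute)
    \<comment> \<open>Outside the ball of radius \<open>d\<close> the factor dist^2 / d^2 is at
      least 1, so this \<open>c\<close> absorbs the growth bounds at both \<open>z\<close> and
      \<open>z0\<close>.\<close>
    define c where "c = M * (1 + wt n (snd z0)) / d\<^sup>2"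
    have c: "c \<ge> 0" using M wt_ge_1[of n "snd z0"] by (simp add: c_def)
    moreover have "U i z \<le> U i z0 + e + c * ((dist z z0)\<^sup>2 * wt n (snd z))" if z: "z \<in> S" for z
    proof (cases "dist z z0 < d")
      case True
      have "0 \<le> c * ((dist z z0)\<^sup>2 * wt n (snd z))"
        using c wt_ge_1[of n "snd z"] by simp
      moreover have "U i z \<le> U i z0 + e"
        using True d(2)[of z] z e by (cases "z = z0") auto
      ultimately show ?thesis by linarith
    next
      case False
      have w: "1 \<le> wt n (snd z)" "1 \<le> wt n (snd z0)" by (rule wt_ge_1)+
      have "U i z - U i z0 \<le> M * (wt n (snd z) + wt n (snd z0))"
        using abs_le_D1[OF growth[OF z, of i]] abs_le_D2[OF growth[OF z0, of i]]
        by (simp add: distrib_left)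
      also have "\<dots> \<le> M * ((1 + wt n (snd z0)) * wt n (snd z))"
      proof (rule mult_left_mono[OF _ M])
        have "wt n (snd z0) * 1 \<le> wt n (snd z0) * wt n (snd z)"
          using w by (intro mult_left_mono) auto
        then show "wt n (snd z) + wt n (snd z0) \<le> (1 + wt n (snd z0)) * wt n (snd z)"
          by (simp add: distrib_right)
      qed
      also have "\<dots> = c * (d\<^sup>2 * wt n (snd z))"
        using d(1) by (simp add: c_def)
      also have "\<dots> \<le> c * ((dist z z0)\<^sup>2 * wt n (snd z))"
        using c w d(1) False by (intro mult_left_mono mult_right_mono power_mono) auto
      finally show ?thesis using e by simp
    qed
    ultimately show ?thesis by blast
  qed
  then have "\<exists>c. \<forall>i. c i \<ge> 0 \<and> (\<forall>z\<in>S. U i z \<le> U i z0 + e + c i * ((dist z z0)\<^sup>2 * wt n (snd z)))"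
    by (intro choice) blast
  then obtain c where c: "\<And>i. c i \<ge> 0"
    "\<And>i z. z \<in> S \<Longrightarrow> U i z \<le> U i z0 + e + c i * ((dist z z0)\<^sup>2 * wt n (snd z))"
    by blast
  \<comment> \<open>The sum over the finitely many light labels dominates each single constant; a
    heavy label varies by at most \<open>e\<close>, so the term \<open>e\<close> already covers
    it.\<close>
  let ?F = "{i. wlen i < N}"
  have "U i z \<le> U i z0 + e + (\<Sum>i\<in>?F. c i) * ((dist z z0)\<^sup>2 * wt n (snd z))" if z: "z \<in> S" for i z
  proof (cases "wlen i < N")
    case True
    have "c i \<le> (\<Sum>i\<in>?F. c i)"
      using True c(1) by (intro member_le_sum finite_wlen_less) auto
    then have "c i * ((dist z z0)\<^sup>2 * wt n (snd z)) \<le> (\<Sum>i\<in>?F. c i) * ((dist z z0)\<^sup>2 * wt n (snd z))"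
      using wt_ge_1[of n "snd z"] by (intro mult_right_mono) auto
    with c(2)[OF z, of i] show ?thesis by linarith
  next
    case False
    have "0 \<le> (\<Sum>i\<in>?F. c i) * ((dist z z0)\<^sup>2 * wt n (snd z))"
      using wt_ge_1[of n "snd z"] c(1) by (intro mult_nonneg_nonneg sum_nonneg) auto
    moreover have "\<bar>U i z\<bar> \<le> e / 2" "\<bar>U i z0\<bar> \<le> e / 2"
      using N False z z0 by auto
    ultimately show ?thesis by linarith
  qed
  then show ?thesis using c(1) by (intro exI[of _ "\<Sum>i\<in>?F. c i"]) (auto intro: sum_nonneg)
qed

section \<open>Envelopes versus the functions themselves\<close>

lemma uenv_le:
  assumes "usc_on ({0..T} \<times> UNIV) (\<lambda>(t, x). u i t x)" and "t \<in> {0..T}"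
  shows "uenv T u i t x \<le> ereal (u i t x)"
proof (rule ereal_le_epsilon2)
  fix e :: real assume "0 < e"
  then have "\<forall>\<^sub>F z in at (t, x) within ({0..T} \<times> UNIV). (\<lambda>(t, x). u i t x) z < u i t x + e"
    using assms unfolding usc_on_def by auto
  then have "\<forall>\<^sub>F z in inf (nhds (t, x)) (principal ({0..<T} \<times> UNIV)).
      (\<lambda>(t, x). ereal (u i t x)) z \<le> ereal (u i t x) + ereal e"
    unfolding eventually_at_filter eventually_inf_principal
    by eventually_elim (use \<open>0 < e\<close> in \<open>auto split: prod.splits\<close>)
  then show "uenv T u i t x \<le> ereal (u i t x) + ereal e"
    unfolding uenv_def by (rule Limsup_bounded)
qed

text \<open>The filter is not punctured, so below T the point itself is seen and the envelope equals
  the function. At T only the bound \<open>uenv_le\<close> remains, and it is what carries a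
  majorant of \<open>u\<close> over to the envelope on all of [0, T].\<close>

lemma uenv_ge:
  assumes "t \<in> {0..<T}"
  shows "ereal (u i t x) \<le> uenv T u i t x"
  unfolding uenv_def Limsup_def
proof (rule INF_greatest)
  fix P assume "P \<in> {P. \<forall>\<^sub>F z in inf (nhds (t, x)) (principal ({0..<T} \<times> UNIV)). P z}"
  then have "P (t, x)"
    unfolding eventually_inf_principal using assms by (auto dest: eventually_nhds_x_imp_x)
  then show "ereal (u i t x) \<le> (SUP z\<in>{z. P z}. case z of (s, y) \<Rightarrow> ereal (u i s y))"
    by (intro SUP_upper2[of "(t, x)"]) auto
qed

lemma lenv_eq_uenv: "lenv T u i t x = - uenv T (\<lambda>i t x. - u i t x) i t x"
proof -
  have "(\<lambda>(s, y). ereal (- u i s y)) = (\<lambda>z. - (case z of (s, y) \<Rightarrow> ereal (u i s y)))"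
    by auto
  then show ?thesis unfolding lenv_def uenv_def by (simp add: ereal_Limsup_uminus)
qed

lemma lenv_ge:
  assumes "lsc_on ({0..T} \<times> UNIV) (\<lambda>(t, x). u i t x)" and "t \<in> {0..T}"
  shows "ereal (u i t x) \<le> lenv T u i t x"
proof -
  have "usc_on ({0..T} \<times> UNIV) (\<lambda>(t, x). - u i t x)"
    using usc_on_uminus[OF assms(1)] unfolding case_prod_unfold .
  from uenv_le[of T "\<lambda>i t x. - u i t x", OF this assms(2), of x]
  have "- ereal (- u i t x) \<le> - uenv T (\<lambda>i t x. - u i t x) i t x"
    by (simp only: ereal_minus_le_minus)
  then show ?thesis by (simp add: lenv_eq_uenv)
qed

lemma lenv_le:
  assumes "t \<in> {0..<T}"
  shows "lenv T u i t x \<le> ereal (u i t x)"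
proof -
  have "- uenv T (\<lambda>i t x. - u i t x) i t x \<le> - ereal (- u i t x)"
    using uenv_ge[OF assms, of "\<lambda>i t x. - u i t x" i x] by (simp only: ereal_minus_le_minus)
  then show ?thesis by (simp add: lenv_eq_uenv)
qed

section \<open>Test families through a contact point\<close>

lemma dist_Pair_sq: "(dist (t, x) (t0, x0))\<^sup>2 = (t - t0)\<^sup>2 + (norm (x - x0))\<^sup>2" for t :: real
  unfolding dist_Pair_Pair by (simp add: dist_real_def dist_norm)

lemma C12_dist_sq:
  "C12 T (\<lambda>t x. (dist (t, x) (t0, x0))\<^sup>2) (\<lambda>t x. 2 * (t - t0)) (\<lambda>t x. 2 *\<^sub>R (x - x0)) (\<lambda>t x. 2 *\<^sub>R mat 1)"
proof -
  have "C12 T (\<lambda>t (x::real^'d). (t - t0)\<^sup>2) (\<lambda>t x. 2 * (t - t0)) (\<lambda>t x. 0) (\<lambda>t x. 0)"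
    by (rule C12_time) (auto intro!: derivative_eq_intros continuous_intros)
  from C12_add[OF this C12_norm_sq[of T x0]] show ?thesis
    by (simp add: dist_Pair_sq)
qed

definition tame :: "real \<Rightarrow> real \<Rightarrow> nat \<Rightarrow> (nat list \<Rightarrow> real \<Rightarrow> real^'d \<Rightarrow> real) \<Rightarrow> bool" where
  "tame T M n u \<longleftrightarrow> (\<forall>i. \<forall>t\<in>{0..T}. \<forall>x. \<bar>u i t x\<bar> \<le> M * wt n x)
     \<and> (\<forall>e>0. \<exists>N. \<forall>i. N \<le> wlen i \<longrightarrow> (\<forall>t\<in>{0..T}. \<forall>x. \<bar>u i t x\<bar> \<le> e))"

lemma tame_uminus: "tame T M n (\<lambda>i t x. - u i t x) \<longleftrightarrow> tame T M n u"
  by (simp add: tame_def)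

lemma tame_majorant:
  assumes tame: "tame T M n u" and usc: "\<And>i. usc_on ({0..T} \<times> UNIV) (\<lambda>(t, x). u i t x)"
    and "t0 \<in> {0..T}" and "0 < e"
  shows "\<exists>c. \<forall>i. \<forall>t\<in>{0..T}. \<forall>x.
    u i t x \<le> u i t0 x0 + e + c * ((dist (t, x) (t0, x0))\<^sup>2 * wt n x)"
proof -
  have "\<exists>c\<ge>0. \<forall>i. \<forall>z\<in>{0..T} \<times> UNIV. (\<lambda>(t, x). u i t x) z
    \<le> (\<lambda>(t, x). u i t x) (t0, x0) + e + c * ((dist z (t0, x0))\<^sup>2 * wt n (snd z))"
  proof (rule uniform_majorant[OF usc])
    show "\<bar>(\<lambda>(t, x). u i t x) z\<bar> \<le> M * wt n (snd z)" if "z \<in> {0..T} \<times> UNIV" for i z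
      using that tame by (auto simp: tame_def)
    show "\<exists>N. \<forall>i. N \<le> wlen i \<longrightarrow> (\<forall>z\<in>{0..T} \<times> UNIV. \<bar>(\<lambda>(t, x). u i t x) z\<bar> \<le> e)" if e: "0 < e" for e
    proof -
      obtain N where "\<forall>i. N \<le> wlen i \<longrightarrow> (\<forall>t\<in>{0..T}. \<forall>x. \<bar>u i t x\<bar> \<le> e)"
        using e tame unfolding tame_def by blast
      then show ?thesis by (intro exI[of _ N]) auto
    qed
  qed (use assms in auto)
  then show ?thesis by auto
qed

definition bump ::
  "nat list \<Rightarrow> (real \<Rightarrow> real^'d \<Rightarrow> real) \<Rightarrow> (nat list \<Rightarrow> real) \<Rightarrow> real \<Rightarrow> nat \<Rightarrow> real \<times> (real^'d)
    \<Rightarrow> nat list \<Rightarrow> real \<Rightarrow> real^'d \<Rightarrow> real" where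
  "bump i0 phi A c n z0 i t x = (if i = i0 then phi t x else A i + c * ((dist (t, x) z0)\<^sup>2 * wt n x))"

lemma bump_self: "bump i0 phi A c n z0 i0 = phi"
  by (simp add: bump_def fun_eq_iff)

lemma bump_other: "i \<noteq> i0 \<Longrightarrow> bump i0 phi A c n (t0, x0) i t0 x0 = A i"
  by (simp add: bump_def)

text \<open>A common continuous bound exists because, away from \<open>i0\<close>, the label enters
  only through the bounded numbers \<open>A i\<close>; \<open>c\<close>, distance and weight are
  shared.\<close>

lemma bump_test_data:
  fixes x0 :: "real^'d"
  assumes phi: "C12 T phi phit Dphi D2phi" and A: "\<And>i. \<bar>A i\<bar> \<le> B"
  obtains pt Dp D2p pb where "\<And>i. C12 T (bump i0 phi A c n (t0, x0) i) (pt i) (Dp i) (D2p i)"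
    and "pt i0 = phit" "Dp i0 = Dphi" "D2p i0 = D2phi"
    and "continuous_on ({0..T} \<times> UNIV) (\<lambda>(t, x). pb t x)"
    and "\<And>i t x. \<bar>bump i0 phi A c n (t0, x0) i t x\<bar> \<le> pb t x"
proof -
  obtain D2 where "C12 T (\<lambda>t (x::real^'d). wt n x) (\<lambda>t x. 0) (\<lambda>t x. (2 * real n * wt (n - 1) x) *\<^sub>R x) D2"
    using C12_wt by blast
  from C12_cmult[OF C12_mult[OF C12_dist_sq[of T t0 x0] this], of c]
  obtain ft Df D2f where r: "C12 T (\<lambda>t x. c * ((dist (t, x) (t0, x0))\<^sup>2 * wt n x)) ft Df D2f"
    by blast
  have "C12 T (\<lambda>t x. A i + c * ((dist (t, x) (t0, x0))\<^sup>2 * wt n x)) (\<lambda>t x. 0 + ft t x)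
      (\<lambda>t x. 0 + Df t x) (\<lambda>t x. 0 + D2f t x)" for i
    by (rule C12_add[OF C12_const r])
  then have 1: "C12 T (bump i0 phi A c n (t0, x0) i) (if i = i0 then phit else ft)
      (if i = i0 then Dphi else Df) (if i = i0 then D2phi else D2f)" for i
    using phi by (cases "i = i0") (simp_all add: bump_self bump_def[abs_def])
  let ?pb = "\<lambda>t x. \<bar>phi t x\<bar> + B + \<bar>c * ((dist (t, x) (t0, x0))\<^sup>2 * wt n x)\<bar>"
  have 2: "continuous_on ({0..T} \<times> UNIV) (\<lambda>(t, x). ?pb t x)"
    using phi r unfolding C12_def case_prod_beta by (auto intro!: continuous_intros)
  have 3: "\<bar>bump i0 phi A c n (t0, x0) i t x\<bar> \<le> ?pb t x" for i t x
  proof -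
    have "0 \<le> B" using A[of "[]"] by linarith
    then show ?thesis
      using A[of i] abs_triangle_ineq[of "A i" "c * ((dist (t, x) (t0, x0))\<^sup>2 * wt n x)"]
      unfolding bump_def by (cases "i = i0") auto
  qed
  show ?thesis
    by (rule that[of "\<lambda>i. if i = i0 then phit else ft" "\<lambda>i. if i = i0 then Dphi else Df"
          "\<lambda>i. if i = i0 then D2phi else D2f" ?pb]) (use 1 2 3 in auto)
qed

lemma tame_bound:
  assumes "tame T M n u" and "t \<in> {0..T}"
  shows "\<bar>u i t x + e\<bar> \<le> M * wt n x + \<bar>e\<bar>"
proof -
  have "\<bar>u i t x\<bar> \<le> M * wt n x" using assms by (auto simp: tame_def)
  then show ?thesis by linarith
qed

text \<open>At the contact point the test family exceeds \<open>u\<close> at the children by only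
  \<open>e / 2\<close>, so a gap of \<open>e\<close> leaves the obstacle part at least
  \<open>e / 2\<close>. The minimum being nonpositive then forces the operator part to be
  nonpositive.\<close>

lemma visc_sub_touch:
  fixes u :: "nat list \<Rightarrow> real \<Rightarrow> real^'d \<Rightarrow> real"
  assumes sub: "visc_sub T p lam sig lamY sigY u"
    and usc: "\<And>i. usc_on ({0..T} \<times> UNIV) (\<lambda>(t, x). u i t x)"
    and tame: "tame T M n u" and K: "enat 0 < Kbar p"
    and phi: "C12 T phi phit Dphi D2phi" and t0: "t0 \<in> {0..<T}"
    and eq: "phi t0 x0 = u i0 t0 x0"
    and above: "\<forall>t\<in>{0..T}. \<forall>x. u i0 t x \<le> phi t x"
    and e: "0 < e" and gap: "\<And>k. enat k < Kbar p \<Longrightarrow> u (i0 @ [k]) t0 x0 + e \<le> u i0 t0 x0"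
  shows "ereal (- phit t0 x0)
    + Flow lam sig lamY sigY x0 (phi t0 x0) (Dphi t0 x0) (D2phi t0 x0) \<le> 0"
proof -
  have t0': "t0 \<in> {0..T}" using t0 by auto
  obtain c where c: "\<And>i t x. t \<in> {0..T} \<Longrightarrow>
      u i t x \<le> u i t0 x0 + e / 2 + c * ((dist (t, x) (t0, x0))\<^sup>2 * wt n x)"
    using tame_majorant[OF tame usc t0' half_gt_zero[OF e], of x0] by blast
  let ?A = "\<lambda>i. u i t0 x0 + e / 2"
  have bd: "\<bar>?A i\<bar> \<le> M * wt n x0 + \<bar>e / 2\<bar>" for i
    by (rule tame_bound[OF tame t0'])
  let ?psi = "bump i0 phi ?A c n (t0, x0)"
  obtain pt Dp D2p pb where psi: "\<And>i. C12 T (?psi i) (pt i) (Dp i) (D2p i)"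
    "pt i0 = phit" "Dp i0 = Dphi" "D2p i0 = D2phi"
    "continuous_on ({0..T} \<times> UNIV) (\<lambda>(t, x). pb t x)" "\<And>i t x. \<bar>?psi i t x\<bar> \<le> pb t x"
    by (rule bump_test_data[where A = ?A and ?i0.0 = i0 and c = "c" and n = n and ?t0.0 = t0 and ?x0.0 = x0, OF phi bd])
      blast
  have "u i t x \<le> ?psi i t x" if "t \<in> {0..T}" for i t x
    using c[OF that, of i x] above[rule_format, OF that, of x] by (simp add: bump_def)
  then have up: "uenv T u i t x \<le> ereal (?psi i t x)" if "t \<in> {0..T}" for i t x
    using that uenv_le[of T u i, OF usc that, of x] by (meson ereal_less_eq(3) order_trans)
  have eqn: "uenv T u i0 t0 x0 = ereal (?psi i0 t0 x0)"
    using uenv_le[of T u i0, OF usc t0', of x0] uenv_ge[OF t0, of u i0 x0] eq by (simp add: bump_self antisym)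
  have "min (ereal (- pt i0 t0 x0)
       + Flow lam sig lamY sigY x0 (?psi i0 t0 x0) (Dp i0 t0 x0) (D2p i0 t0 x0))
     (ereal (?psi i0 t0 x0 - (SUP k\<in>{k. enat k < Kbar p}. ?psi (i0 @ [k]) t0 x0))) \<le> 0"
    by (rule sub[unfolded visc_sub_def, rule_format, of ?psi pt Dp D2p pb t0 i0 x0], intro conjI allI ballI) (rule psi t0 eqn up | assumption)+
  moreover have "(SUP k\<in>{k. enat k < Kbar p}. ?psi (i0 @ [k]) t0 x0) \<le> u i0 t0 x0 - e / 2"
  proof (rule cSUP_least)
    show "{k. enat k < Kbar p} \<noteq> {}" using K by auto
    show "?psi (i0 @ [k]) t0 x0 \<le> u i0 t0 x0 - e / 2" if "k \<in> {k. enat k < Kbar p}" for k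
      using gap[of k] that by (simp add: bump_other)
  qed
  then have "0 < ereal (?psi i0 t0 x0 - (SUP k\<in>{k. enat k < Kbar p}. ?psi (i0 @ [k]) t0 x0))"
    using eq e by (simp add: bump_self)
  ultimately show ?thesis
    by (simp add: min_le_iff_disj psi bump_self)
qed

text \<open>Here both parts of the minimum are informative. The children of the test family sit at u
  - e, so the obstacle part bounds each child by its parent up to the arbitrary
  \<open>e\<close>.\<close>

lemma visc_super_touch:
  fixes u :: "nat list \<Rightarrow> real \<Rightarrow> real^'d \<Rightarrow> real"
  assumes super: "visc_super T p lam sig lamY sigY u"
    and lsc: "\<And>i. lsc_on ({0..T} \<times> UNIV) (\<lambda>(t, x). u i t x)"
    and tame: "tame T M n u"
    and phi: "C12 T phi phit Dphi D2phi" and t0: "t0 \<in> {0..<T}"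
    and eq: "phi t0 x0 = u i0 t0 x0"
    and below: "\<forall>t\<in>{0..T}. \<forall>x. phi t x \<le> u i0 t x"
    and e: "0 < e"
  shows "0 \<le> ereal (- phit t0 x0)
    + Fup lam sig lamY sigY x0 (phi t0 x0) (Dphi t0 x0) (D2phi t0 x0)"
    and "enat k < Kbar p \<Longrightarrow> u (i0 @ [k]) t0 x0 \<le> u i0 t0 x0 + e"
proof -
  have t0': "t0 \<in> {0..T}" using t0 by auto
  have usc: "usc_on ({0..T} \<times> UNIV) (\<lambda>(t, x). - u i t x)" for i
    using usc_on_uminus[OF lsc[of i]] unfolding case_prod_unfold .
  have tame': "tame T M n (\<lambda>i t x. - u i t x)" using tame by (simp only: tame_uminus)
  obtain c where c: "\<And>i t x. t \<in> {0..T} \<Longrightarrow>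
      - u i t x \<le> - u i t0 x0 + e + c * ((dist (t, x) (t0, x0))\<^sup>2 * wt n x)"
    using tame_majorant[OF tame' usc t0' e, of x0] by blast
  let ?A = "\<lambda>i. u i t0 x0 + - e"
  have bd: "\<bar>?A i\<bar> \<le> M * wt n x0 + \<bar>- e\<bar>" for i
    by (rule tame_bound[OF tame t0'])
  let ?psi = "bump i0 phi ?A (- c) n (t0, x0)"
  obtain pt Dp D2p pb where psi: "\<And>i. C12 T (?psi i) (pt i) (Dp i) (D2p i)"
    "pt i0 = phit" "Dp i0 = Dphi" "D2p i0 = D2phi"
    "continuous_on ({0..T} \<times> UNIV) (\<lambda>(t, x). pb t x)" "\<And>i t x. \<bar>?psi i t x\<bar> \<le> pb t x"
    by (rule bump_test_data[where A = ?A and ?i0.0 = i0 and c = "- c" and n = n and ?t0.0 = t0 and ?x0.0 = x0, OF phi bd])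
      blast
  have "?psi i t x \<le> u i t x" if "t \<in> {0..T}" for i t x
    using c[OF that, of i x] below[rule_format, OF that, of x] by (simp add: bump_def)
  then have up: "ereal (?psi i t x) \<le> lenv T u i t x" if "t \<in> {0..T}" for i t x
    using that lenv_ge[of T u i, OF lsc that, of x] by (meson ereal_less_eq(3) order_trans)
  have eqn: "lenv T u i0 t0 x0 = ereal (?psi i0 t0 x0)"
    using lenv_ge[of T u i0, OF lsc t0', of x0] lenv_le[OF t0, of u i0 x0] eq by (simp add: bump_self antisym)
  have *: "0 \<le> min (ereal (- pt i0 t0 x0)
       + Fup lam sig lamY sigY x0 (?psi i0 t0 x0) (Dp i0 t0 x0) (D2p i0 t0 x0))
     (ereal (?psi i0 t0 x0 - (SUP k\<in>{k. enat k < Kbar p}. ?psi (i0 @ [k]) t0 x0)))"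
    by (rule super[unfolded visc_super_def, rule_format, of ?psi pt Dp D2p pb t0 i0 x0], intro conjI allI ballI) (rule psi t0 eqn up | assumption)+
  then show "0 \<le> ereal (- phit t0 x0)
    + Fup lam sig lamY sigY x0 (phi t0 x0) (Dphi t0 x0) (D2phi t0 x0)"
    by (simp add: psi bump_self)
  assume k: "enat k < Kbar p"
  have "?psi (i0 @ [k]) t0 x0 \<le> (SUP k\<in>{k. enat k < Kbar p}. ?psi (i0 @ [k]) t0 x0)"
  proof (rule cSUP_upper)
    \<comment> \<open>There may be infinitely many children; the common bound of the test data makes
      their real supremum meaningful.\<close>
    show "bdd_above ((\<lambda>k. ?psi (i0 @ [k]) t0 x0) ` {k. enat k < Kbar p})"
      using psi(6) by (intro bdd_aboveI[of _ "pb t0 x0"]) (auto dest: abs_le_D1)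
  qed (use k in auto)
  then show "u (i0 @ [k]) t0 x0 \<le> u i0 t0 x0 + e"
    using * eq by (simp add: bump_self bump_other)
qed

text \<open>The slice t = T of the same family is used; the gap removes the obstacle, and only the
  comparison with \<open>g\<close> can hold.\<close>

lemma term_sub_touch:
  fixes u :: "nat list \<Rightarrow> real \<Rightarrow> real^'d \<Rightarrow> real"
  assumes sub: "term_sub T p g u"
    and usc: "\<And>i. usc_on ({0..T} \<times> UNIV) (\<lambda>(t, x). u i t x)"
    and tame: "tame T M n u" and K: "enat 0 < Kbar p" and T: "0 < T"
    and phi: "C12 T phi phit Dphi D2phi"
    and eq: "phi T x0 = u i0 T x0"
    and above: "\<And>x. u i0 T x \<le> phi T x"
    and e: "0 < e" and gap: "\<And>k. enat k < Kbar p \<Longrightarrow> u (i0 @ [k]) T x0 + e \<le> u i0 T x0"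
  shows "u i0 T x0 \<le> g i0 x0"
proof -
  have T': "T \<in> {0..T}" using T by auto
  obtain c where c: "\<And>i t x. t \<in> {0..T} \<Longrightarrow>
      u i t x \<le> u i T x0 + e / 2 + c * ((dist (t, x) (T, x0))\<^sup>2 * wt n x)"
    using tame_majorant[OF tame usc T' half_gt_zero[OF e], of x0] by blast
  let ?A = "\<lambda>i. u i T x0 + e / 2"
  have bd: "\<bar>?A i\<bar> \<le> M * wt n x0 + \<bar>e / 2\<bar>" for i
    by (rule tame_bound[OF tame T'])
  let ?psi = "bump i0 phi ?A c n (T, x0)"
  obtain pt Dp D2p pb where psi: "\<And>i. C12 T (?psi i) (pt i) (Dp i) (D2p i)"
    "continuous_on ({0..T} \<times> UNIV) (\<lambda>(t, x). pb t x)" "\<And>i t x. \<bar>?psi i t x\<bar> \<le> pb t x"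
    by (rule bump_test_data[where A = ?A and ?i0.0 = i0 and c = "c" and n = n and ?t0.0 = T and ?x0.0 = x0, OF phi bd])
      blast
  have cont: "continuous_on UNIV (pb T)"
  proof -
    have "continuous_on UNIV (\<lambda>x::real^'d. (T, x))" by (intro continuous_intros)
    from continuous_on_compose2[OF psi(2) this] T show ?thesis by (auto simp: image_subset_iff)
  qed
  have up: "u i T x \<le> ?psi i T x" for i x
    using c[OF T', of i x] above[of x] by (simp add: bump_def)
  have "min (?psi i0 T x0 - g i0 x0)
     (?psi i0 T x0 - (SUP k\<in>{k. enat k < Kbar p}. ?psi (i0 @ [k]) T x0)) \<le> 0"
    using sub[unfolded term_sub_def, rule_format, of "\<lambda>i. ?psi i T" "pb T" i0 x0]
      C12_imp_C2[OF psi(1) T'] psi(3) cont up eq by (simp add: bump_self)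
  moreover have "(SUP k\<in>{k. enat k < Kbar p}. ?psi (i0 @ [k]) T x0) \<le> u i0 T x0 - e / 2"
  proof (rule cSUP_least)
    show "{k. enat k < Kbar p} \<noteq> {}" using K by auto
    show "?psi (i0 @ [k]) T x0 \<le> u i0 T x0 - e / 2" if "k \<in> {k. enat k < Kbar p}" for k
      using gap[of k] that by (simp add: bump_other)
  qed
  ultimately show ?thesis
    using eq e by (auto simp: min_le_iff_disj bump_self)
qed

lemma term_super_touch:
  fixes u :: "nat list \<Rightarrow> real \<Rightarrow> real^'d \<Rightarrow> real"
  assumes super: "term_super T p g u"
    and lsc: "\<And>i. lsc_on ({0..T} \<times> UNIV) (\<lambda>(t, x). u i t x)"
    and tame: "tame T M n u" and T: "0 < T"
    and phi: "C12 T phi phit Dphi D2phi"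
    and eq: "phi T x0 = u i0 T x0"
    and below: "\<And>x. phi T x \<le> u i0 T x"
    and e: "0 < e"
  shows "g i0 x0 \<le> u i0 T x0"
    and "enat k < Kbar p \<Longrightarrow> u (i0 @ [k]) T x0 \<le> u i0 T x0 + e"
proof -
  have T': "T \<in> {0..T}" using T by auto
  have usc: "usc_on ({0..T} \<times> UNIV) (\<lambda>(t, x). - u i t x)" for i
    using usc_on_uminus[OF lsc[of i]] unfolding case_prod_unfold .
  have tame': "tame T M n (\<lambda>i t x. - u i t x)" using tame by (simp only: tame_uminus)
  obtain c where c: "\<And>i t x. t \<in> {0..T} \<Longrightarrow>
      - u i t x \<le> - u i T x0 + e + c * ((dist (t, x) (T, x0))\<^sup>2 * wt n x)"
    using tame_majorant[OF tame' usc T' e, of x0] by blast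
  let ?A = "\<lambda>i. u i T x0 + - e"
  have bd: "\<bar>?A i\<bar> \<le> M * wt n x0 + \<bar>- e\<bar>" for i
    by (rule tame_bound[OF tame T'])
  let ?psi = "bump i0 phi ?A (- c) n (T, x0)"
  obtain pt Dp D2p pb where psi: "\<And>i. C12 T (?psi i) (pt i) (Dp i) (D2p i)"
    "continuous_on ({0..T} \<times> UNIV) (\<lambda>(t, x). pb t x)" "\<And>i t x. \<bar>?psi i t x\<bar> \<le> pb t x"
    by (rule bump_test_data[where A = ?A and ?i0.0 = i0 and c = "- c" and n = n and ?t0.0 = T and ?x0.0 = x0, OF phi bd])
      blast
  have cont: "continuous_on UNIV (pb T)"
  proof -
    have "continuous_on UNIV (\<lambda>x::real^'d. (T, x))" by (intro continuous_intros)
    from continuous_on_compose2[OF psi(2) this] T show ?thesis by (auto simp: image_subset_iff)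
  qed
  have up: "?psi i T x \<le> u i T x" for i x
    using c[OF T', of i x] below[of x] by (simp add: bump_def)
  have *: "0 \<le> min (?psi i0 T x0 - g i0 x0)
     (?psi i0 T x0 - (SUP k\<in>{k. enat k < Kbar p}. ?psi (i0 @ [k]) T x0))"
    using super[unfolded term_super_def, rule_format, of "\<lambda>i. ?psi i T" "pb T" i0 x0]
      C12_imp_C2[OF psi(1) T'] psi(3) cont up eq by (simp add: bump_self)
  then show "g i0 x0 \<le> u i0 T x0" using eq by (simp add: bump_self)
  assume k: "enat k < Kbar p"
  have "?psi (i0 @ [k]) T x0 \<le> (SUP k\<in>{k. enat k < Kbar p}. ?psi (i0 @ [k]) T x0)"
  proof (rule cSUP_upper)
    show "bdd_above ((\<lambda>k. ?psi (i0 @ [k]) T x0) ` {k. enat k < Kbar p})"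
      using psi(3) by (intro bdd_aboveI[of _ "pb T x0"]) (auto dest: abs_le_D1)
  qed (use k in auto)
  then show "u (i0 @ [k]) T x0 \<le> u i0 T x0 + e"
    using * eq by (simp add: bump_self bump_other)
qed

section \<open>Doubling of variables\<close>

lemma usc_on_compose:
  assumes f: "usc_on S f" and g: "continuous_on S' g" and sub: "g ` S' \<subseteq> S"
  shows "usc_on S' (\<lambda>z. f (g z))"
  unfolding usc_on_def
proof (intro ballI allI impI)
  fix z c assume z: "z \<in> S'" and c: "f (g z) < c"
  have "g z \<in> S" using sub z by auto
  from usc_on_nhds[OF f this c] have ev: "\<forall>\<^sub>F y in nhds (g z). y \<in> S \<longrightarrow> f y < c" .
  have "(g \<longlongrightarrow> g z) (at z within S')" using g z by (auto simp: continuous_on_def)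
  from eventually_compose_filterlim[OF ev this]
  have "\<forall>\<^sub>F y in at z within S'. g y \<in> S \<longrightarrow> f (g y) < c" .
  moreover have "\<forall>\<^sub>F y in at z within S'. y \<in> S'"
    by (auto simp: eventually_at_filter)
  ultimately show "\<forall>\<^sub>F y in at z within S'. f (g y) < c"
    by eventually_elim (use sub in auto)
qed

lemma usc_on_bounded_above:
  fixes a :: "'z::heine_borel \<Rightarrow> real"
  assumes "closed S" "usc_on S a" "bounded {z \<in> S. a z0 \<le> a z}" "z0 \<in> S"
  shows "\<exists>A. \<forall>z\<in>S. a z \<le> A"
proof -
  obtain R where R: "0 < R" "{z \<in> S. a z0 \<le> a z} \<subseteq> ball z0 R"
    using bounded_subset_ballD[OF assms(3)] by blast
  let ?K = "S \<inter> cball z0 R"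
  have "\<exists>z\<in>?K. \<forall>y\<in>?K. a y \<le> a z"
  proof (rule usc_on_attains_max)
    show "compact ?K" using assms(1) by (intro closed_Int_compact) auto
    show "?K \<noteq> {}" using R(1) assms(4) by auto
    show "usc_on ?K a" using assms(2) by (rule usc_on_subset) auto
  qed
  then obtain m where m: "m \<in> ?K" "\<And>y. y \<in> ?K \<Longrightarrow> a y \<le> a m" by blast
  have "a z \<le> a m" if "z \<in> S" for z
  proof (cases "a z0 \<le> a z")
    case True
    with that R(2) have "z \<in> ball z0 R" by blast
    then show ?thesis using m(2)[of z] that by auto
  next
    case False
    have "a z0 \<le> a m" using m(2)[of z0] assms(4) R(1) by auto
    with False show ?thesis by simp
  qed
  then show ?thesis by blast
qed

text \<open>Maximisers of a(x) + b(y) - r |x - y|^2 exist by coercivity and have nonnegative value,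
  as the diagonal point \<open>z0\<close> competes. Since a and b are bounded above, r |x - y|^2
  stays bounded, and r tending to infinity merges the two points.\<close>

lemma doubling:
  fixes a b :: "'z::heine_borel \<Rightarrow> real"
  assumes cl: "closed S" and ua: "usc_on S a" and ub: "usc_on S b"
    and ba: "\<And>c. bounded {z \<in> S. c \<le> a z}" and bb: "\<And>c. bounded {z \<in> S. c \<le> b z}"
    and z0: "z0 \<in> S" "a z0 + b z0 = 0" and le: "\<And>z. z \<in> S \<Longrightarrow> a z + b z \<le> 0"
  obtains X Y :: "nat \<Rightarrow> 'z" and r :: "nat \<Rightarrow> real" and z where
    "\<And>n. X n \<in> S" "\<And>n. Y n \<in> S" "z \<in> S" "X \<longlonglongrightarrow> z" "Y \<longlonglongrightarrow> z" "a z + b z = 0"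
    "\<And>n. 0 \<le> r n"
    "\<And>n y y'. y \<in> S \<Longrightarrow> y' \<in> S \<Longrightarrow> a y + b y' - r n * (dist y y')\<^sup>2
        \<le> a (X n) + b (Y n) - r n * (dist (X n) (Y n))\<^sup>2"
    "(\<lambda>n. r n * (dist (X n) (Y n))\<^sup>2) \<longlonglongrightarrow> 0" "(\<lambda>n. a (X n) + b (Y n)) \<longlonglongrightarrow> 0"
proof -
  obtain A where A: "\<And>z. z \<in> S \<Longrightarrow> a z \<le> A" using usc_on_bounded_above[OF cl ua ba z0(1)] by blast
  obtain B where B: "\<And>z. z \<in> S \<Longrightarrow> b z \<le> B" using usc_on_bounded_above[OF cl ub bb z0(1)] by blast
  \<comment> \<open>If a(u) < -B or b(v) < -A, then a(u) + b(v) < 0, which is no better than the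
    pair (z0, z0); so the search can be confined to the remaining bounded set.\<close>
  have "bounded ({z \<in> S. - B \<le> a z} \<union> {z \<in> S. - A \<le> b z})" using ba bb by simp
  from bounded_subset_ballD[OF this, of z0] obtain R where
    R: "0 < R" "{z \<in> S. - B \<le> a z} \<union> {z \<in> S. - A \<le> b z} \<subseteq> ball z0 R" by blast
  define K where "K = S \<inter> cball z0 R"
  have K: "compact K" "z0 \<in> K" "K \<subseteq> S"
    using cl z0 R(1) by (auto simp: K_def intro: closed_Int_compact)
  have inK: "z \<in> K" if "z \<in> S" "- B \<le> a z \<or> - A \<le> b z" for z
    using that R(2) by (auto simp: K_def)
  let ?h = "\<lambda>r z. a (fst z) + b (snd z) - r * (dist (fst z) (snd z))\<^sup>2"
  have ex: "\<exists>x\<in>K. \<exists>y\<in>K. (\<forall>u\<in>S. \<forall>v\<in>S. ?h r (u, v) \<le> ?h r (x, y))" if r: "0 \<le> r" for r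
  proof -
    have "usc_on (K \<times> K) (\<lambda>z. a (fst z) + b (snd z) + (- r * (dist (fst z) (snd z))\<^sup>2))"
      by (intro usc_on_add usc_on_compose[OF ua] usc_on_compose[OF ub] continuous_imp_usc_on continuous_intros)
        (use K in auto)
    then have "\<exists>z\<in>K \<times> K. \<forall>y\<in>K \<times> K. ?h r y \<le> ?h r z"
      using K by (intro usc_on_attains_max compact_Times) auto
    then obtain x y where xy: "x \<in> K" "y \<in> K" "\<And>u v. u \<in> K \<Longrightarrow> v \<in> K \<Longrightarrow> ?h r (u, v) \<le> ?h r (x, y)"
      by fastforce
    have pos: "0 \<le> ?h r (x, y)" using xy(3)[OF K(2) K(2)] z0(2) by simp
    have "?h r (u, v) \<le> ?h r (x, y)" if "u \<in> S" "v \<in> S" for u v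
    proof (cases "u \<in> K \<and> v \<in> K")
      case False
      have "0 \<le> r * (dist u v)\<^sup>2" using r by simp
      moreover have "a u + b v \<le> 0"
        using False inK[OF that(1)] inK[OF that(2)] A[OF that(1)] B[OF that(2)] by fastforce
      ultimately show ?thesis using pos by simp
    qed (use xy in auto)
    with xy show ?thesis by blast
  qed
  have "\<forall>n::nat. \<exists>p. fst p \<in> K \<and> snd p \<in> K \<and> (\<forall>u\<in>S. \<forall>v\<in>S. ?h (real (Suc n)) (u, v) \<le> ?h (real (Suc n)) p)"
  proof
    fix n :: nat
    from ex[of "real (Suc n)"] obtain x y where "x \<in> K" "y \<in> K"
      "\<forall>u\<in>S. \<forall>v\<in>S. ?h (real (Suc n)) (u, v) \<le> ?h (real (Suc n)) (x, y)" by auto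
    then show "\<exists>p. fst p \<in> K \<and> snd p \<in> K \<and> (\<forall>u\<in>S. \<forall>v\<in>S. ?h (real (Suc n)) (u, v) \<le> ?h (real (Suc n)) p)"
      by (intro exI[of _ "(x, y)"]) simp
  qed
  from choice[OF this] obtain P where P: "\<And>n. fst (P n) \<in> K" "\<And>n. snd (P n) \<in> K"
    "\<And>n u v. u \<in> S \<Longrightarrow> v \<in> S \<Longrightarrow> ?h (real (Suc n)) (u, v) \<le> ?h (real (Suc n)) (P n)" by blast
  have "seq_compact (K \<times> K)" using K(1) compact_Times compact_imp_seq_compact by blast
  moreover have "\<forall>n. P n \<in> K \<times> K" using P by (simp add: mem_Times_iff)
  ultimately obtain l s where l: "l \<in> K \<times> K" "strict_mono s" "(P \<circ> s) \<longlonglongrightarrow> l"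
    by (rule seq_compactE)
  define X where "X n = fst (P (s n))" for n
  define Y where "Y n = snd (P (s n))" for n
  define r where "r n = real (Suc (s n))" for n
  have S: "X n \<in> S" "Y n \<in> S" for n using P K by (auto simp: X_def Y_def)
  have Xl: "X \<longlonglongrightarrow> fst l" and Yl: "Y \<longlonglongrightarrow> snd l"
    using tendsto_fst[OF l(3)] tendsto_snd[OF l(3)] by (simp_all add: X_def[abs_def] Y_def[abs_def] o_def)
  have max: "a u + b v - r n * (dist u v)\<^sup>2 \<le> a (X n) + b (Y n) - r n * (dist (X n) (Y n))\<^sup>2"
    if "u \<in> S" "v \<in> S" for u v n
    using P(3)[OF that, of "s n"] unfolding X_def Y_def r_def fst_conv snd_conv .
  have nn: "r n * (dist (X n) (Y n))\<^sup>2 \<le> a (X n) + b (Y n)" for n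
    using max[OF z0(1) z0(1), of n] z0(2) by simp
  have r0: "0 \<le> r n * (dist (X n) (Y n))\<^sup>2" for n by (simp add: r_def)
  have "(\<lambda>n. (dist (X n) (Y n))\<^sup>2) \<longlonglongrightarrow> 0"
  proof (rule tendsto_sandwich[where f = "\<lambda>_. 0" and h = "\<lambda>n. (A + B) / real (Suc n)"])
    show "\<forall>\<^sub>F n in sequentially. (dist (X n) (Y n))\<^sup>2 \<le> (A + B) / real (Suc n)"
    proof (rule always_eventually, rule allI)
      fix n
      have "real (Suc n) * (dist (X n) (Y n))\<^sup>2 \<le> r n * (dist (X n) (Y n))\<^sup>2"
        using seq_suble[OF l(2), of n] by (intro mult_right_mono) (auto simp: r_def)
      also have "\<dots> \<le> A + B" using nn[of n] A[OF S(1), of n] B[OF S(2), of n] by linarith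
      finally show "(dist (X n) (Y n))\<^sup>2 \<le> (A + B) / real (Suc n)"
        by (simp add: field_simps del: of_nat_Suc)
    qed
    show "(\<lambda>n. (A + B) / real (Suc n)) \<longlonglongrightarrow> 0"
      using lim_const_over_n LIMSEQ_Suc by blast
  qed auto
  moreover have "(\<lambda>n. (dist (X n) (Y n))\<^sup>2) \<longlonglongrightarrow> (dist (fst l) (snd l))\<^sup>2"
    by (intro tendsto_intros Xl Yl)
  ultimately have "(dist (fst l) (snd l))\<^sup>2 = 0" using LIMSEQ_unique by blast
  then have eq: "snd l = fst l" by simp
  have lS: "fst l \<in> S" using l(1) K(3) by auto
  \<comment> \<open>Upper semicontinuity bounds the values by the value at the common limit, while
    they dominate the nonnegative penalty: hence the limit is a maximum point and the penalty tends
    to 0.\<close>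
  have ev: "\<forall>\<^sub>F n in sequentially. a (X n) + b (Y n) < a (fst l) + b (fst l) + e" if "0 < e" for e
  proof -
    have "\<forall>\<^sub>F n in sequentially. a (X n) < a (fst l) + e / 2"
      using that by (intro usc_on_eventually_seq[OF ua lS Xl S(1)]) simp
    moreover have "\<forall>\<^sub>F n in sequentially. b (Y n) < b (fst l) + e / 2"
      using that by (intro usc_on_eventually_seq[OF ub lS Yl[unfolded eq] S(2)]) simp
    ultimately show ?thesis by eventually_elim simp
  qed
  have "0 \<le> a (fst l) + b (fst l) + e" if e: "0 < e" for e
  proof -
    obtain k where "a (X k) + b (Y k) < a (fst l) + b (fst l) + e"
      using eventually_happens[OF ev[OF e]] by auto
    then show ?thesis using nn[of k] r0[of k] by linarith
  qed
  then have zero: "a (fst l) + b (fst l) = 0"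
    using le[OF lS] field_le_epsilon[of 0 "a (fst l) + b (fst l)"] by force
  have ab: "(\<lambda>n. a (X n) + b (Y n)) \<longlonglongrightarrow> 0"
  proof (rule order_tendstoI)
    show "\<forall>\<^sub>F n in sequentially. c < a (X n) + b (Y n)" if "c < 0" for c
      using that nn r0 by (intro always_eventually allI) (meson less_le_trans order_trans)
    show "\<forall>\<^sub>F n in sequentially. a (X n) + b (Y n) < c" if "0 < c" for c
      using ev[OF that] zero by simp
  qed
  have "(\<lambda>n. r n * (dist (X n) (Y n))\<^sup>2) \<longlonglongrightarrow> 0"
    by (rule tendsto_sandwich[OF _ _ tendsto_const ab]) (use nn r0 in auto)
  moreover have "0 \<le> r n" for n by (simp add: r_def)
  ultimately show thesis
    using that[of X Y "fst l" r] S lS Xl Yl eq zero max ab by simp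
qed

lemma wt_Suc: "wt (Suc n) x = (1 + (norm x)\<^sup>2) * wt n x"
  by (simp add: wt_def)

lemma norm_le_one_plus_sq: "norm x \<le> 1 + (norm x)\<^sup>2"
proof -
  have "0 \<le> (norm x - 1)\<^sup>2" by simp
  then have "2 * norm x \<le> 1 + (norm x)\<^sup>2" by (simp add: power2_diff)
  then show ?thesis using norm_ge_zero[of x] by linarith
qed

text \<open>Among the labels at which the weighted maximum is attained, a longest one is chosen: at it the
  obstacle part of the equation is inactive.\<close>

lemma maximal_contact:
  fixes D :: "nat list \<Rightarrow> real \<times> (real^'d) \<Rightarrow> real" and T :: real
  defines "S \<equiv> {0..T} \<times> UNIV"
  assumes usc: "\<And>i. usc_on S (D i)"
    and growth: "\<And>i z. z \<in> S \<Longrightarrow> D i z \<le> M * wt m (snd z)"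
    and decay: "\<And>e. 0 < e \<Longrightarrow> \<exists>N. \<forall>i. N \<le> wlen i \<longrightarrow> (\<forall>z\<in>S. D i z \<le> e)"
    and chi_cont: "continuous_on S chi" and chi_ge: "\<And>z. z \<in> S \<Longrightarrow> wt (Suc m) (snd z) \<le> chi z"
    and pos: "z1 \<in> S" "0 < D i1 z1"
  obtains theta i0 z0 where "0 < theta" "z0 \<in> S" "D i0 z0 = theta * chi z0"
    "\<And>i z. z \<in> S \<Longrightarrow> D i z \<le> theta * chi z"
    "\<And>i z. z \<in> S \<Longrightarrow> D i z = theta * chi z \<Longrightarrow> wlen i \<le> wlen i0"
proof -
  have chi1: "1 \<le> chi z" if "z \<in> S" for z
    using chi_ge[OF that] wt_ge_1[of "Suc m" "snd z"] by linarith
  define q where "q i z = D i z / chi z" for i z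
  have D_le: "D i z \<le> c * chi z \<longleftrightarrow> q i z \<le> c" and D_eq: "D i z = c * chi z \<longleftrightarrow> q i z = c"
    if "z \<in> S" for i z c
    using chi1[OF that] by (auto simp: q_def field_simps)
  \<comment> \<open>The ratio \<open>q\<close> reaches \<open>v\<close> at the given point, so
    maximisation may ignore all labels and points where it stays below \<open>v\<close>; finitely
    many labels and a compact set remain.\<close>
  define v where "v = q i1 z1"
  have v: "0 < v" using pos chi1[OF pos(1)] by (simp add: v_def q_def)
  obtain N where N: "\<And>i z. N \<le> wlen i \<Longrightarrow> z \<in> S \<Longrightarrow> D i z \<le> v / 2"
    using decay[of "v / 2"] v by auto
  have small: "q i z < v" if "N \<le> wlen i" "z \<in> S" for i z
  proof -
    have "v / 2 * 1 \<le> v / 2 * chi z"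
      using chi1[OF that(2)] v by (intro mult_left_mono) auto
    then have "D i z \<le> v / 2 * chi z" using N[OF that] by linarith
    then have "q i z \<le> v / 2" using D_le[OF that(2)] by blast
    then show ?thesis using v by simp
  qed
  \<comment> \<open>Beyond \<open>R\<close> one has |M| < v (1 + |x|^2), and the extra factor 1 +
    |x|^2 in \<open>chi\<close> beats the growth; the last term puts \<open>z1\<close>
    inside.\<close>
  define R where "R = \<bar>M\<bar> / v + 1 + norm (snd z1)"
  define K where "K = {0..T} \<times> cball (0::real^'d) R"
  have KS: "K \<subseteq> S" by (auto simp: K_def S_def)
  have z1K: "z1 \<in> K" using pos(1) v by (auto simp: K_def S_def R_def)
  have far: "q i z < v" if "z \<in> S" "z \<notin> K" for i z
  proof -
    have "R < norm (snd z)" using that by (auto simp: K_def S_def)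
    then have "\<bar>M\<bar> / v < norm (snd z)" using norm_ge_zero[of "snd z1"] unfolding R_def by linarith
    then have "\<bar>M\<bar> / v < 1 + (norm (snd z))\<^sup>2" using norm_le_one_plus_sq[of "snd z"] by linarith
    then have "\<bar>M\<bar> < v * (1 + (norm (snd z))\<^sup>2)" using v by (simp add: field_simps)
    moreover have w: "1 \<le> wt m (snd z)" by (rule wt_ge_1)
    ultimately have "\<bar>M\<bar> * wt m (snd z) < v * (1 + (norm (snd z))\<^sup>2) * wt m (snd z)"
      by (intro mult_strict_right_mono) auto
    also have "\<dots> \<le> v * chi z"
      using chi_ge[OF that(1)] v by (simp add: wt_Suc mult.assoc)
    finally have "\<bar>M\<bar> * wt m (snd z) < v * chi z" .
    moreover have "M * wt m (snd z) \<le> \<bar>M\<bar> * wt m (snd z)" using w by (intro mult_right_mono) auto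
    ultimately have "D i z < v * chi z" using growth[OF that(1), of i] by linarith
    then show ?thesis using chi1[OF that(1)] by (simp add: q_def field_simps)
  qed
  have uscq: "usc_on K (q i)" for i
    unfolding usc_on_def
  proof (intro ballI allI impI)
    fix z c assume z: "z \<in> K" and c: "q i z < c"
    have zS: "z \<in> S" using z KS by auto
    have lim: "(chi \<longlongrightarrow> chi z) (at z within K)"
      using continuous_on_subset[OF chi_cont KS] z by (simp add: continuous_on_def)
    have "((\<lambda>y. c * chi y) \<longlongrightarrow> c * chi z) (at z within K)" by (intro tendsto_intros lim)
    moreover have "D i z < c * chi z" using c chi1[OF zS] by (simp add: q_def field_simps)
    then obtain e where e: "D i z < e" "e < c * chi z" using dense by blast
    ultimately have "\<forall>\<^sub>F y in at z within K. e < c * chi y"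
      using order_tendstoD(1) by blast
    moreover have "\<forall>\<^sub>F y in at z within K. D i y < e"
      using usc_on_subset[OF usc KS] z e by (auto simp: usc_on_def)
    moreover have "\<forall>\<^sub>F y in at z within K. y \<in> K" by (auto simp: eventually_at_filter)
    ultimately show "\<forall>\<^sub>F y in at z within K. q i y < c"
    proof eventually_elim
      case (elim y)
      then have "y \<in> S" using KS by auto
      from chi1[OF this] elim show ?case by (simp add: q_def field_simps)
    qed
  qed
  have "\<exists>z\<in>K. \<forall>y\<in>K. q i y \<le> q i z" for i
    using z1K by (intro usc_on_attains_max uscq) (auto simp: K_def intro: compact_Times)
  then have "\<forall>i. \<exists>z. z \<in> K \<and> (\<forall>y\<in>K. q i y \<le> q i z)" by blast
  from choice[OF this] obtain mx where mx: "\<And>i. mx i \<in> K" "\<And>i y. y \<in> K \<Longrightarrow> q i y \<le> q i (mx i)" by blast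
  let ?F = "{i. wlen i < N}"
  have i1: "i1 \<in> ?F" using small[of i1 z1] pos(1) by (force simp: v_def)
  define theta where "theta = Max ((\<lambda>i. q i (mx i)) ` ?F)"
  have fin: "finite ((\<lambda>i. q i (mx i)) ` ?F)" by (intro finite_imageI finite_wlen_less)
  have "theta \<in> (\<lambda>i. q i (mx i)) ` ?F" unfolding theta_def using fin i1 by (intro Max_in) auto
  then obtain j where j: "theta = q j (mx j)" by auto
  have up: "q i (mx i) \<le> theta" if "i \<in> ?F" for i
    unfolding theta_def using fin that by (intro Max_ge) auto
  have v_le: "v \<le> theta" using mx(2)[OF z1K, of i1] up[OF i1] by (simp add: v_def)
  have q_le: "q i z \<le> theta" if z: "z \<in> S" for i z
  proof -
    consider "N \<le> wlen i" | "z \<notin> K" | "i \<in> ?F" "z \<in> K" by fastforce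
    then show ?thesis
    proof cases
      case 1
      then show ?thesis using small[OF 1 z] v_le by simp
    next
      case 2
      then show ?thesis using far[OF z 2, of i] v_le by simp
    next
      case 3
      then show ?thesis using mx(2)[of z i] up[of i] by linarith
    qed
  qed
  \<comment> \<open>The contact labels: all are light, since heavy ones stay below v <= theta, so
    one of largest weight exists.\<close>
  define C where "C = {i. \<exists>z\<in>S. q i z = theta}"
  have "C \<subseteq> ?F"
  proof
    fix i assume "i \<in> C"
    then obtain z where "z \<in> S" "q i z = theta" by (auto simp: C_def)
    then have "\<not> N \<le> wlen i" using small[of i z] v_le by auto
    then show "i \<in> ?F" by simp
  qed
  then have finC: "finite (wlen ` C)" using finite_wlen_less[of N] finite_subset by blast
  moreover have "j \<in> C" using j mx(1)[of j] KS by (auto simp: C_def)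
  ultimately have "Max (wlen ` C) \<in> wlen ` C" by (intro Max_in) auto
  then obtain i0 where i0: "i0 \<in> C" "wlen i0 = Max (wlen ` C)" by auto
  then obtain z0 where z0: "z0 \<in> S" "q i0 z0 = theta" by (auto simp: C_def)
  show thesis
  proof (rule that)
    show "0 < theta" using v v_le by simp
    show "z0 \<in> S" "D i0 z0 = theta * chi z0" using z0 D_eq by blast+
    show "D i z \<le> theta * chi z" if "z \<in> S" for i z using D_le q_le that by blast
    show "wlen i \<le> wlen i0" if "z \<in> S" "D i z = theta * chi z" for i z
    proof -
      have "i \<in> C" using that D_eq by (auto simp: C_def)
      then show ?thesis using i0(2) finC by simp
    qed
  qed
qed

section \<open>Comparison\<close>

definition chi :: "real \<Rightarrow> real \<Rightarrow> nat \<Rightarrow> real \<Rightarrow> real^'d \<Rightarrow> real" where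
  "chi kappa T n t x = exp (kappa * (T - t)) * wt n x"

definition grad_chi :: "real \<Rightarrow> real \<Rightarrow> nat \<Rightarrow> real \<Rightarrow> real^'d \<Rightarrow> real^'d" where
  "grad_chi kappa T n t x = (exp (kappa * (T - t)) * (2 * real n * wt (n - 1) x)) *\<^sub>R x"

lemma C12_chi:
  "\<exists>D2. C12 T (chi kappa T n :: real \<Rightarrow> real^'d \<Rightarrow> real) (\<lambda>t x. - kappa * chi kappa T n t x) (grad_chi kappa T n) D2"
proof -
  obtain D2 where wt: "C12 T (\<lambda>t (x::real^'d). wt n x) (\<lambda>t x. 0) (\<lambda>t x. (2 * real n * wt (n - 1) x) *\<^sub>R x) D2"
    using C12_wt by blast
  have time: "C12 T (\<lambda>t (x::real^'d). exp (kappa * (T - t))) (\<lambda>t x. - kappa * exp (kappa * (T - t))) (\<lambda>t x. 0) (\<lambda>t x. 0)"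
    by (rule C12_time) (auto intro!: derivative_eq_intros continuous_intros)
  have "(\<lambda>t x. - kappa * exp (kappa * (T - t)) * wt n x + exp (kappa * (T - t)) * 0)
      = (\<lambda>t (x::real^'d). - kappa * chi kappa T n t x)"
    and "(\<lambda>t x. exp (kappa * (T - t)) *\<^sub>R ((2 * real n * wt (n - 1) x) *\<^sub>R x) + wt n x *\<^sub>R 0)
      = (grad_chi kappa T n :: real \<Rightarrow> real^'d \<Rightarrow> real^'d)"
    and "(\<lambda>t x. exp (kappa * (T - t)) * wt n x) = (chi kappa T n :: real \<Rightarrow> real^'d \<Rightarrow> real)"
    by (auto simp: chi_def grad_chi_def fun_eq_iff)
  with C12_mult[OF time wt] show ?thesis by metis
qed

text \<open>Covers both sides of the doubling: \<open>c\<close> and \<open>r\<close> are theta / 2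
  and the penalty parameter for the subsolution, and their negatives for the supersolution.\<close>

lemma C12_penalty:
  fixes x0 :: "real^'d"
  shows "\<exists>D2. C12 T (\<lambda>t x. A + (c * chi kappa T n t x + r * (dist (t, x) (t0, x0))\<^sup>2))
    (\<lambda>t x. - (c * kappa * chi kappa T n t x) + 2 * r * (t - t0))
    (\<lambda>t x. c *\<^sub>R grad_chi kappa T n t x + (2 * r) *\<^sub>R (x - x0)) D2"
proof -
  obtain D2 where "C12 T (chi kappa T n :: real \<Rightarrow> real^'d \<Rightarrow> real)
      (\<lambda>t x. - kappa * chi kappa T n t x) (grad_chi kappa T n) D2"
    using C12_chi by blast
  from C12_add[OF C12_const[of T A] C12_add[OF C12_cmult[OF this, of c] C12_cmult[OF C12_dist_sq[of T t0 x0], of r]]]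
  show ?thesis by (auto simp: mult.assoc mult.left_commute mult.commute[of _ 2])
qed

lemma chi_ge_wt:
  assumes "0 \<le> kappa" "t \<le> T"
  shows "wt n x \<le> chi kappa T n t x"
proof -
  have "1 * wt n x \<le> exp (kappa * (T - t)) * wt n x"
    using assms wt_ge_1[of n x] by (intro mult_right_mono) auto
  then show ?thesis by (simp add: chi_def)
qed

lemma chi_continuous: "continuous_on UNIV (\<lambda>z. chi kappa T n (fst z) (snd z))"
  unfolding chi_def wt_def by (intro continuous_intros)

lemma level_set_bounded:
  fixes f :: "real \<times> (real^'d) \<Rightarrow> real"
  assumes S: "S \<subseteq> {0..T} \<times> UNIV" and th: "0 < th"
    and le: "\<And>z. z \<in> S \<Longrightarrow> f z \<le> M * wt m (snd z) - th * wt (Suc m) (snd z)"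
  shows "bounded {z \<in> S. c \<le> f z}"
proof (rule bounded_subset)
  \<comment> \<open>Beyond this radius M - th (1 + |x|^2) <= -(|c| + 1), and multiplying by a weight
    at least 1 keeps the value below \<open>c\<close>.\<close>
  define R where "R = (\<bar>M\<bar> + \<bar>c\<bar> + 1) / th"
  show "bounded ({0..T} \<times> cball (0::real^'d) R)"
    by (intro bounded_Times) auto
  show "{z \<in> S. c \<le> f z} \<subseteq> {0..T} \<times> cball 0 R"
  proof
    fix z assume "z \<in> {z \<in> S. c \<le> f z}"
    then have z: "z \<in> S" "c \<le> f z" by auto
    have "norm (snd z) \<le> R"
    proof (rule ccontr)
      assume "\<not> norm (snd z) \<le> R"
      then have "R < 1 + (norm (snd z))\<^sup>2" using norm_le_one_plus_sq[of "snd z"] by linarith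
      then have "\<bar>M\<bar> + \<bar>c\<bar> + 1 < th * (1 + (norm (snd z))\<^sup>2)"
        using th by (simp add: R_def field_simps)
      then have neg: "M - th * (1 + (norm (snd z))\<^sup>2) \<le> - (\<bar>c\<bar> + 1)" by linarith
      have "f z \<le> (M - th * (1 + (norm (snd z))\<^sup>2)) * wt m (snd z)"
        using le[OF z(1)] by (simp add: wt_Suc algebra_simps)
      also have "\<dots> \<le> - (\<bar>c\<bar> + 1) * wt m (snd z)"
        using neg wt_ge_1[of m "snd z"] by (intro mult_right_mono) auto
      also have "\<dots> \<le> - (\<bar>c\<bar> + 1) * 1"
        using wt_ge_1[of m "snd z"] by (intro mult_left_mono_neg) auto
      finally show False using z(2) abs_ge_minus_self[of c] by simp
    qed
    then show "z \<in> {0..T} \<times> cball 0 R" using subsetD[OF S z(1)] by (auto simp: mem_Times_iff)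
  qed
qed

context drift_control
begin

lemma b_growth: "norm (b x) \<le> (norm (b 0) + L) * (1 + norm x)"
proof -
  have "norm (b x) \<le> norm (b 0) + norm (b x - b 0)" by (rule norm_triangle_sub)
  also have "\<dots> \<le> norm (b 0) + L * norm x" using b_lip[of x 0] by simp
  also have "\<dots> \<le> (norm (b 0) + L) * (1 + norm x)"
    using L_nonneg by (simp add: algebra_simps)
  finally show ?thesis .
qed

text \<open>The gradient of chi is 2 n chi x / (1 + |x|^2), and (1 + |x|) |x| <= 2 (1 + |x|^2)
  matches the linear growth of \<open>b\<close>. The constant is free of \<open>kappa\<close>, which
  can thus be chosen from it.\<close>

lemma drift_chi:
  assumes "0 < n"
  shows "\<bar>b x \<bullet> grad_chi kappa T n t x\<bar> \<le> 4 * real n * (norm (b 0) + L) * chi kappa T n t x"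
proof -
  let ?E = "exp (kappa * (T - t))"
  have "\<bar>b x \<bullet> grad_chi kappa T n t x\<bar> \<le> norm (b x) * norm (grad_chi kappa T n t x)"
    by (rule Cauchy_Schwarz_ineq2)
  also have "norm (grad_chi kappa T n t x) = ?E * (2 * real n * wt (n - 1) x) * norm x"
    using wt_ge_1[of "n - 1" x] by (simp add: grad_chi_def abs_mult)
  also have "norm (b x) * (?E * (2 * real n * wt (n - 1) x) * norm x)
      \<le> ((norm (b 0) + L) * (1 + norm x)) * (?E * (2 * real n * wt (n - 1) x) * norm x)"
    using wt_ge_1[of "n - 1" x] by (intro mult_right_mono b_growth) auto
  also have "\<dots> = (?E * (2 * real n * wt (n - 1) x) * (norm (b 0) + L)) * ((1 + norm x) * norm x)"
    by (simp add: algebra_simps)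
  also have "\<dots> \<le> (?E * (2 * real n * wt (n - 1) x) * (norm (b 0) + L)) * (2 * (1 + (norm x)\<^sup>2))"
  proof (rule mult_left_mono)
    show "(1 + norm x) * norm x \<le> 2 * (1 + (norm x)\<^sup>2)"
      using norm_le_one_plus_sq[of x] by (simp add: distrib_right power2_eq_square)
    show "0 \<le> ?E * (2 * real n * wt (n - 1) x) * (norm (b 0) + L)"
      using wt_ge_1[of "n - 1" x] L_nonneg by auto
  qed
  also have "\<dots> = 4 * real n * (norm (b 0) + L) * (?E * ((1 + (norm x)\<^sup>2) * wt (n - 1) x))"
    by (simp add: algebra_simps)
  also have "(1 + (norm x)\<^sup>2) * wt (n - 1) x = wt n x"
    using wt_Suc[of "n - 1" x] assms by simp
  finally show ?thesis by (simp add: chi_def)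
qed

text \<open>The doubling penalty contributes only \<open>2 r (b x - b y) \<bullet> (x - y) \<le> 2 r L |x - y|\<^sup>2\<close>; the
  derivatives of \<open>\<chi>\<close> leave the strictly positive term.\<close>

lemma doubled_inequality:
  assumes n: "0 < n" and th: "0 \<le> th" and r: "0 \<le> r"
    and kappa: "kappa = 4 * real n * (norm (b 0) + L) + L + 1"
    and sub: "- (- (th * kappa * chi kappa T n t x) + 2 * r * (t - s))
        + (f x p - b x \<bullet> (th *\<^sub>R grad_chi kappa T n t x + (2 * r) *\<^sub>R (x - y))) \<le> 0"
    and sup: "0 \<le> - (- (- th * kappa * chi kappa T n s y) + 2 * - r * (s - t))
        + (f y q - b y \<bullet> (- th *\<^sub>R grad_chi kappa T n s y + (2 * - r) *\<^sub>R (y - x)))"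
  shows "(L + 1) * (th * chi kappa T n t x + th * chi kappa T n s y)
     \<le> f y q - f x p + 2 * L * (r * (norm (x - y))\<^sup>2)"
proof -
  let ?k = "4 * real n * (norm (b 0) + L)"
  have "(b x - b y) \<bullet> (x - y) \<le> norm (b x - b y) * norm (x - y)"
    by (rule norm_cauchy_schwarz)
  also have "\<dots> \<le> L * norm (x - y) * norm (x - y)" by (intro mult_right_mono b_lip) auto
  finally have "2 * r * ((b x - b y) \<bullet> (x - y)) \<le> 2 * r * (L * norm (x - y) * norm (x - y))"
    using r by (intro mult_left_mono) auto
  then have pen: "2 * r * ((b x - b y) \<bullet> (x - y)) \<le> 2 * L * (r * (norm (x - y))\<^sup>2)"
    by (simp add: power2_eq_square algebra_simps)
  have dr: "th * (b x \<bullet> grad_chi kappa T n t x) \<le> th * (?k * chi kappa T n t x)"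
    "th * (b y \<bullet> grad_chi kappa T n s y) \<le> th * (?k * chi kappa T n s y)"
    by (intro mult_left_mono th abs_le_D1[OF drift_chi[OF n]])+
  have "2 * r * ((b x - b y) \<bullet> (x - y)) = 2 * r * (b x \<bullet> (x - y)) + 2 * r * (b y \<bullet> (y - x))"
    by (simp add: algebra_simps inner_diff_left inner_diff_right)
  moreover have "b x \<bullet> (th *\<^sub>R grad_chi kappa T n t x + (2 * r) *\<^sub>R (x - y))
      = th * (b x \<bullet> grad_chi kappa T n t x) + 2 * r * (b x \<bullet> (x - y))"
    by (simp add: inner_add_right)
  moreover have "b y \<bullet> (- th *\<^sub>R grad_chi kappa T n s y + (2 * - r) *\<^sub>R (y - x))
      = - (th * (b y \<bullet> grad_chi kappa T n s y)) - 2 * r * (b y \<bullet> (y - x))"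
    by (simp add: inner_add_right inner_diff_right)
  \<comment> \<open>The time derivatives of the penalty coincide in the two inequalities and cancel
    on subtraction.\<close>
  moreover have "2 * r * (t - s) = - (2 * r * (s - t))" by (simp add: algebra_simps)
  moreover have "th * kappa * v = th * (?k * v) + (L + 1) * (th * v)" for v
    by (simp add: kappa algebra_simps)
  ultimately show ?thesis
    using sub sup pen dr by (simp add: distrib_left)
qed

end

text \<open>Children of a longest contact label stay strictly below the maximum; only finitely many of them
  are not negligible, so the gap is uniform.\<close>

lemma children_gap:
  fixes U V :: "nat list \<Rightarrow> real \<times> (real^'d) \<Rightarrow> real"
  assumes U: "\<And>i. usc_on S (U i)" and V: "\<And>i. usc_on S (V i)"
    and X: "\<And>n. X n \<in> S" "X \<longlonglongrightarrow> z" and Y: "\<And>n. Y n \<in> S" "Y \<longlonglongrightarrow> z" and z: "z \<in> S"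
    and decU: "\<And>e. 0 < e \<Longrightarrow> \<exists>N. \<forall>i. N \<le> wlen i \<longrightarrow> (\<forall>z\<in>S. U i z \<le> e)"
    and decV: "\<And>e. 0 < e \<Longrightarrow> \<exists>N. \<forall>i. N \<le> wlen i \<longrightarrow> (\<forall>z\<in>S. V i z \<le> e)"
    and lim: "(\<lambda>n. U i0 (X n) + V i0 (Y n)) \<longlonglongrightarrow> delta" and pos: "0 < delta"
    and gap: "\<And>k. U (i0 @ [k]) z + V (i0 @ [k]) z < delta"
  shows "\<exists>e>0. \<forall>\<^sub>F n in sequentially. \<forall>k.
    U (i0 @ [k]) (X n) + V (i0 @ [k]) (Y n) + e \<le> U i0 (X n) + V i0 (Y n)"
proof -
  obtain N1 where N1: "\<And>i z. N1 \<le> wlen i \<Longrightarrow> z \<in> S \<Longrightarrow> U i z \<le> delta / 4"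
    using decU[of "delta / 4"] pos by auto
  obtain N2 where N2: "\<And>i z. N2 \<le> wlen i \<Longrightarrow> z \<in> S \<Longrightarrow> V i z \<le> delta / 4"
    using decV[of "delta / 4"] pos by auto
  define N where "N = max N1 N2"
  let ?g = "\<lambda>k. delta - (U (i0 @ [k]) z + V (i0 @ [k]) z)"
  \<comment> \<open>The slack of the finitely many relevant children, capped by
    \<open>delta / 2\<close>. Errors of \<open>e / 8\<close> for each function and
    \<open>e / 4\<close> for the parent consume half of it.\<close>
  define e where "e = Min (insert (delta / 2) (?g ` {..<N}))"
  have "0 < e" unfolding e_def using gap pos by (subst Min_gr_iff) auto
  have e_le: "e \<le> delta / 2" "k < N \<Longrightarrow> e \<le> ?g k" for k
    unfolding e_def by (rule Min_le; simp)+
  have ev: "\<forall>\<^sub>F n in sequentially. \<forall>k\<in>{..<N}.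
      U (i0 @ [k]) (X n) < U (i0 @ [k]) z + e / 8 \<and> V (i0 @ [k]) (Y n) < V (i0 @ [k]) z + e / 8"
    using \<open>0 < e\<close>
    by (intro eventually_ball_finite ballI eventually_conj usc_on_eventually_seq[OF U z X(2,1)]
        usc_on_eventually_seq[OF V z Y(2,1)]) auto
  have "\<forall>\<^sub>F n in sequentially. delta - e / 4 < U i0 (X n) + V i0 (Y n)"
    using \<open>0 < e\<close> by (intro order_tendstoD(1)[OF lim]) simp
  with ev have "\<forall>\<^sub>F n in sequentially. \<forall>k.
      U (i0 @ [k]) (X n) + V (i0 @ [k]) (Y n) + e / 2 \<le> U i0 (X n) + V i0 (Y n)"
  proof eventually_elim
    case (elim n)
    show ?case
    proof
      fix k
      show "U (i0 @ [k]) (X n) + V (i0 @ [k]) (Y n) + e / 2 \<le> U i0 (X n) + V i0 (Y n)"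
      proof (cases "k < N")
        case True
        then have "U (i0 @ [k]) (X n) < U (i0 @ [k]) z + e / 8" "V (i0 @ [k]) (Y n) < V (i0 @ [k]) z + e / 8"
          using elim(1) by auto
        with elim(2) e_le(2)[OF True] show ?thesis by linarith
      next
        case False
        \<comment> \<open>The last letter \<open>k\<close> alone contributes k + 1 to the
          weight.\<close>
        then have "N1 \<le> wlen (i0 @ [k])" "N2 \<le> wlen (i0 @ [k])" by (auto simp: N_def wlen_def)
        with N1[OF _ X(1)] N2[OF _ Y(1)]
        have "U (i0 @ [k]) (X n) \<le> delta / 4" "V (i0 @ [k]) (Y n) \<le> delta / 4" by blast+
        with elim(2) e_le(1) \<open>0 < e\<close> show ?thesis by linarith
      qed
    qed
  qed
  then show ?thesis using \<open>0 < e\<close> by (intro exI[of _ "e / 2"]) auto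
qed

lemma tameD:
  assumes "tame T M m u"
  shows "t \<in> {0..T} \<Longrightarrow> \<bar>u i t x\<bar> \<le> M * wt m x"
    and "0 < e \<Longrightarrow> \<exists>N. \<forall>i. N \<le> wlen i \<longrightarrow> (\<forall>t\<in>{0..T}. \<forall>x. \<bar>u i t x\<bar> \<le> e)"
  using assms by (auto simp: tame_def)

context drift_control
begin

lemma comparison:
  fixes ub wb :: "nat list \<Rightarrow> real \<Rightarrow> real^'d \<Rightarrow> real"
  assumes T: "0 < T" and K: "enat 0 < Kbar p" and g: "\<And>i. continuous_on UNIV (g i)"
    and lsc: "\<And>i. lsc_on ({0..T} \<times> UNIV) (\<lambda>(t, x). wb i t x)"
    and usc: "\<And>i. usc_on ({0..T} \<times> UNIV) (\<lambda>(t, x). ub i t x)"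
    and super: "visc_super T p lam sig lamY sigY wb" and sub: "visc_sub T p lam sig lamY sigY ub"
    and tsuper: "term_super T p g wb" and tsub: "term_sub T p g ub"
    and tame_w: "tame T M m wb" and tame_u: "tame T M m ub"
    and t1: "t1 \<in> {0..T}"
  shows "ub i1 t1 x1 \<le> wb i1 t1 x1"
proof (rule ccontr)
  assume neg: "\<not> ub i1 t1 x1 \<le> wb i1 t1 x1"
  define S :: "(real \<times> (real^'d)) set" where "S = {0..T} \<times> UNIV"
  define U where "U i z = ub i (fst z) (snd z)" for i z
  define V where "V i z = - wb i (fst z) (snd z)" for i z
  have uscU: "usc_on S (U i)" for i
    using usc[of i] unfolding U_def[abs_def] S_def case_prod_unfold .
  have uscV: "usc_on S (V i)" for i
    using usc_on_uminus[OF lsc[of i]] unfolding V_def[abs_def] S_def case_prod_unfold .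
  have inS: "fst z \<in> {0..T}" if "z \<in> S" for z using that by (auto simp: S_def)
  have growU: "U i z \<le> M * wt m (snd z)" and growV: "V i z \<le> M * wt m (snd z)" if "z \<in> S" for i z
    using tameD(1)[OF tame_u inS[OF that], of i "snd z"] tameD(1)[OF tame_w inS[OF that], of i "snd z"]
    unfolding U_def V_def by linarith+
  have decU: "\<exists>N. \<forall>i. N \<le> wlen i \<longrightarrow> (\<forall>z\<in>S. U i z \<le> e)" if "0 < e" for e
  proof -
    from tameD(2)[OF tame_u that] obtain N where
      N: "\<forall>i. N \<le> wlen i \<longrightarrow> (\<forall>t\<in>{0..T}. \<forall>x. \<bar>ub i t x\<bar> \<le> e)" ..
    have "U i z \<le> e" if "N \<le> wlen i" "z \<in> S" for i z
      using N[rule_format, OF that(1) inS[OF that(2)], of "snd z"] unfolding U_def by linarith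
    then show ?thesis by blast
  qed
  have decV: "\<exists>N. \<forall>i. N \<le> wlen i \<longrightarrow> (\<forall>z\<in>S. V i z \<le> e)" if "0 < e" for e
  proof -
    from tameD(2)[OF tame_w that] obtain N where
      N: "\<forall>i. N \<le> wlen i \<longrightarrow> (\<forall>t\<in>{0..T}. \<forall>x. \<bar>wb i t x\<bar> \<le> e)" ..
    have "V i z \<le> e" if "N \<le> wlen i" "z \<in> S" for i z
      using N[rule_format, OF that(1) inS[OF that(2)], of "snd z"] unfolding V_def by linarith
    then show ?thesis by blast
  qed
  define n where "n = Suc m"
  define kappa where "kappa = 4 * real n * (norm (b 0) + L) + L + 1"
  have kappa: "0 \<le> kappa" using L_nonneg by (simp add: kappa_def)
  let ?chi = "\<lambda>z. chi kappa T n (fst z) (snd z)"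
  have chi_ge: "wt n (snd z) \<le> ?chi z" if "z \<in> S" for z
    using inS[OF that] by (intro chi_ge_wt kappa) auto
  have chi_cont: "continuous_on S' ?chi" for S' by (rule continuous_on_subset[OF chi_continuous]) auto
  have decD: "\<exists>N. \<forall>i. N \<le> wlen i \<longrightarrow> (\<forall>z\<in>S. U i z + V i z \<le> e)" if e: "0 < e" for e
  proof -
    obtain N1 where N1: "\<And>i z. N1 \<le> wlen i \<Longrightarrow> z \<in> S \<Longrightarrow> U i z \<le> e / 2"
      using decU[OF half_gt_zero[OF e]] by blast
    obtain N2 where N2: "\<And>i z. N2 \<le> wlen i \<Longrightarrow> z \<in> S \<Longrightarrow> V i z \<le> e / 2"
      using decV[OF half_gt_zero[OF e]] by blast
    have "U i z + V i z \<le> e" if "max N1 N2 \<le> wlen i" "z \<in> S" for i z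
      using N1[of i z] N2[of i z] that by simp
    then show ?thesis by blast
  qed
  have growD: "U i z + V i z \<le> (2 * M) * wt m (snd z)" if "z \<in> S" for i z
    using growU[OF that, of i] growV[OF that, of i] by simp
  obtain theta i0 z0 where theta: "0 < theta" and z0: "z0 \<in> S" "U i0 z0 + V i0 z0 = theta * ?chi z0"
    and max: "\<And>i z. z \<in> S \<Longrightarrow> U i z + V i z \<le> theta * ?chi z"
    and longest: "\<And>i z. z \<in> S \<Longrightarrow> U i z + V i z = theta * ?chi z \<Longrightarrow> wlen i \<le> wlen i0"
  proof (rule maximal_contact[of T "\<lambda>i z. U i z + V i z" "2 * M" m ?chi "(t1, x1)" i1, folded S_def n_def])
    show "usc_on S (\<lambda>z. U i z + V i z)" for i by (intro usc_on_add uscU uscV)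
    show "(t1, x1) \<in> S" using t1 by (simp add: S_def)
    show "0 < U i1 (t1, x1) + V i1 (t1, x1)" using neg by (simp add: U_def V_def)
  qed (use growD decD chi_ge chi_cont in \<open>blast+\<close>)
  \<comment> \<open>On the slice t = T the doubled test functions need to touch only in x, as the
    terminal conditions ask. Without contact at T, the whole strip is used and the limit point lies
    below T.\<close>
  define S' where "S' = (if \<exists>x. U i0 (T, x) + V i0 (T, x) = theta * ?chi (T, x) then {T} \<times> UNIV else S)"
  have S': "S' \<subseteq> S" "closed S'"
    using T by (auto simp: S'_def S_def intro!: closed_Times)
  obtain z0' where z0': "z0' \<in> S'" "U i0 z0' + V i0 z0' = theta * ?chi z0'"
    using z0 by (cases "\<exists>x. U i0 (T, x) + V i0 (T, x) = theta * ?chi (T, x)") (auto simp: S'_def)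
  \<comment> \<open>The weight is shared equally so that each of \<open>?a\<close> and
    \<open>?b\<close> has bounded superlevel sets on its own.\<close>
  let ?th = "theta / 2"
  let ?a = "\<lambda>z. U i0 z + - ?th * ?chi z" and ?b = "\<lambda>z. V i0 z + - ?th * ?chi z"
  have usc': "usc_on S' ?a" "usc_on S' ?b"
    by (intro usc_on_add usc_on_subset[OF uscU S'(1)] usc_on_subset[OF uscV S'(1)]
        continuous_imp_usc_on continuous_intros chi_cont)+
  have S'_sub: "S' \<subseteq> {0..T} \<times> UNIV" using S'(1) by (simp add: S_def)
  have chi_ge': "?th * wt (Suc m) (snd z) \<le> ?th * ?chi z" if "z \<in> S'" for z
    using chi_ge[of z] theta that S'(1) by (auto simp: n_def)
  have bdd: "bounded {z \<in> S'. c \<le> ?a z}" "bounded {z \<in> S'. c \<le> ?b z}" for c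
  proof -
    have "?a z \<le> M * wt m (snd z) - ?th * wt (Suc m) (snd z)"
      "?b z \<le> M * wt m (snd z) - ?th * wt (Suc m) (snd z)" if "z \<in> S'" for z
      using growU[of z i0] growV[of z i0] chi_ge'[OF that] subsetD[OF S'(1) that] by simp_all
    then show "bounded {z \<in> S'. c \<le> ?a z}" "bounded {z \<in> S'. c \<le> ?b z}"
      by (intro level_set_bounded[OF S'_sub half_gt_zero[OF theta]]; blast)+
  qed
  have le0: "?a z + ?b z \<le> 0" if "z \<in> S'" for z
    using max[of z i0] subsetD[OF S'(1) that] by simp
  have ab_z0': "?a z0' + ?b z0' = 0" using z0'(2) by simp
  obtain X Y r z where XY: "\<And>n. X n \<in> S'" "\<And>n. Y n \<in> S'" "z \<in> S'" "X \<longlonglongrightarrow> z" "Y \<longlonglongrightarrow> z" "?a z + ?b z = 0"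
    and r: "\<And>n. 0 \<le> r n"
    and pen: "\<And>n y y'. y \<in> S' \<Longrightarrow> y' \<in> S' \<Longrightarrow> ?a y + ?b y' - r n * (dist y y')\<^sup>2
        \<le> ?a (X n) + ?b (Y n) - r n * (dist (X n) (Y n))\<^sup>2"
    and r0: "(\<lambda>n. r n * (dist (X n) (Y n))\<^sup>2) \<longlonglongrightarrow> 0"
    and ab0: "(\<lambda>n. ?a (X n) + ?b (Y n)) \<longlonglongrightarrow> 0"
  proof (rule doubling[OF S'(2) usc' bdd z0'(1) ab_z0' le0])
    fix X Y r z
    assume "\<And>n. X n \<in> S'" "\<And>n. Y n \<in> S'" "z \<in> S'" "X \<longlonglongrightarrow> z" "Y \<longlonglongrightarrow> z" "?a z + ?b z = 0"
      "\<And>n. 0 \<le> r n"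
      "\<And>n y y'. y \<in> S' \<Longrightarrow> y' \<in> S' \<Longrightarrow> ?a y + ?b y' - r n * (dist y y')\<^sup>2
        \<le> ?a (X n) + ?b (Y n) - r n * (dist (X n) (Y n))\<^sup>2"
      "(\<lambda>n. r n * (dist (X n) (Y n))\<^sup>2) \<longlonglongrightarrow> 0" "(\<lambda>n. ?a (X n) + ?b (Y n)) \<longlonglongrightarrow> 0"
    then show thesis by (rule that)
  qed
  have XS: "X n \<in> S" "Y n \<in> S" "z \<in> S" for n using XY S'(1) by auto
  have chiX: "(\<lambda>n. ?chi (X n)) \<longlonglongrightarrow> ?chi z" and chiY: "(\<lambda>n. ?chi (Y n)) \<longlonglongrightarrow> ?chi z"
    by (rule continuous_on_tendsto_compose[OF chi_cont[of UNIV]]; use XY in auto)+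
  define delta where "delta = theta * ?chi z"
  have "1 \<le> ?chi z" using chi_ge[OF XS(3)] wt_ge_1[of n "snd z"] by linarith
  then have delta: "0 < delta" using theta by (simp add: delta_def)
  have "(\<lambda>n. (?a (X n) + ?b (Y n)) + (?th * ?chi (X n) + ?th * ?chi (Y n)))
      \<longlonglongrightarrow> 0 + (?th * ?chi z + ?th * ?chi z)"
    by (intro tendsto_intros ab0 chiX chiY)
  then have lim: "(\<lambda>n. U i0 (X n) + V i0 (Y n)) \<longlonglongrightarrow> delta"
    by (simp add: delta_def)
  have child: "U (i0 @ [k]) z + V (i0 @ [k]) z < delta" for k
  proof -
    have "\<not> wlen (i0 @ [k]) \<le> wlen i0" by (simp add: wlen_def)
    then have "U (i0 @ [k]) z + V (i0 @ [k]) z \<noteq> theta * ?chi z" using longest[OF XS(3)] by blast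
    with max[OF XS(3), of "i0 @ [k]"] show ?thesis by (simp add: delta_def)
  qed
  have "\<exists>e>0. \<forall>\<^sub>F n in sequentially. \<forall>k.
    U (i0 @ [k]) (X n) + V (i0 @ [k]) (Y n) + e \<le> U i0 (X n) + V i0 (Y n)"
    by (rule children_gap[OF uscU uscV XS(1) XY(4) XS(2) XY(5) XS(3) decU decV lim delta child])
  then obtain e where e: "0 < e" and gap: "\<forall>\<^sub>F n in sequentially. \<forall>k.
    U (i0 @ [k]) (X n) + V (i0 @ [k]) (Y n) + e \<le> U i0 (X n) + V i0 (Y n)"
    by blast
  \<comment> \<open>Freezing one variable of the doubled maximum at \<open>Y j\<close> or
    \<open>X j\<close> gives test functions touching \<open>ub\<close> from above at
    \<open>X j\<close> and \<open>wb\<close> from below at \<open>Y j\<close>.\<close>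
  define phi where "phi j t x = (U i0 (X j) - ?th * ?chi (X j) - r j * (dist (X j) (Y j))\<^sup>2)
      + (?th * chi kappa T n t x + r j * (dist (t, x) (Y j))\<^sup>2)" for j t x
  define psi where "psi j t x = (- V i0 (Y j) + ?th * ?chi (Y j) + r j * (dist (X j) (Y j))\<^sup>2)
      + (- ?th * chi kappa T n t x + - r j * (dist (t, x) (X j))\<^sup>2)" for j t x
  have phi_eq: "phi j (fst (X j)) (snd (X j)) = ub i0 (fst (X j)) (snd (X j))" for j
    by (simp add: phi_def U_def)
  have psi_eq: "psi j (fst (Y j)) (snd (Y j)) = wb i0 (fst (Y j)) (snd (Y j))" for j
    by (simp add: psi_def V_def dist_commute)
  have above: "ub i0 t x \<le> phi j t x" if "(t, x) \<in> S'" for j t x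
    using pen[OF that XY(2)[of j], of j] by (simp add: phi_def U_def)
  have below: "psi j t x \<le> wb i0 t x" if "(t, x) \<in> S'" for j t x
    using pen[OF XY(1)[of j] that, of j] by (simp add: psi_def V_def dist_commute)
  have "\<exists>D2. C12 T (phi j) (\<lambda>t x. - (?th * kappa * chi kappa T n t x) + 2 * r j * (t - fst (Y j)))
    (\<lambda>t x. ?th *\<^sub>R grad_chi kappa T n t x + (2 * r j) *\<^sub>R (x - snd (Y j))) D2" for j
    using C12_penalty[of T _ ?th kappa n "r j" "fst (Y j)" "snd (Y j)"] unfolding phi_def[abs_def] prod.collapse .
  then have "\<forall>j. \<exists>D2. C12 T (phi j) (\<lambda>t x. - (?th * kappa * chi kappa T n t x) + 2 * r j * (t - fst (Y j)))
    (\<lambda>t x. ?th *\<^sub>R grad_chi kappa T n t x + (2 * r j) *\<^sub>R (x - snd (Y j))) D2" by blast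
  from choice[OF this] obtain D2phi where C12_phi': "\<forall>j. C12 T (phi j) (\<lambda>t x. - (?th * kappa * chi kappa T n t x) + 2 * r j * (t - fst (Y j)))
    (\<lambda>t x. ?th *\<^sub>R grad_chi kappa T n t x + (2 * r j) *\<^sub>R (x - snd (Y j))) (D2phi j)" ..
  note C12_phi = C12_phi'[rule_format]
  have "\<exists>D2. C12 T (psi j) (\<lambda>t x. - (- ?th * kappa * chi kappa T n t x) + 2 * - r j * (t - fst (X j)))
    (\<lambda>t x. - ?th *\<^sub>R grad_chi kappa T n t x + (2 * - r j) *\<^sub>R (x - snd (X j))) D2" for j
    using C12_penalty[of T _ "- ?th" kappa n "- r j" "fst (X j)" "snd (X j)"] unfolding psi_def[abs_def] prod.collapse .
  then have "\<forall>j. \<exists>D2. C12 T (psi j) (\<lambda>t x. - (- ?th * kappa * chi kappa T n t x) + 2 * - r j * (t - fst (X j)))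
    (\<lambda>t x. - ?th *\<^sub>R grad_chi kappa T n t x + (2 * - r j) *\<^sub>R (x - snd (X j))) D2" by blast
  from choice[OF this] obtain D2psi where C12_psi': "\<forall>j. C12 T (psi j) (\<lambda>t x. - (- ?th * kappa * chi kappa T n t x) + 2 * - r j * (t - fst (X j)))
    (\<lambda>t x. - ?th *\<^sub>R grad_chi kappa T n t x + (2 * - r j) *\<^sub>R (x - snd (X j))) (D2psi j)" ..
  note C12_psi = C12_psi'[rule_format]
  have e2: "0 < e / 2" using e by simp
  have UV: "U i (X j) = ub i (fst (X j)) (snd (X j))" "V i (Y j) = - wb i (fst (Y j)) (snd (Y j))" for i j
    by (simp_all add: U_def V_def)
  \<comment> \<open>Half of the gap for the difference pays for the slack in the supersolution's
    obstacle bound; the other half is a gap for \<open>ub\<close> alone.\<close>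
  have combine: "ub (i0 @ [k]) (fst (X j)) (snd (X j)) + e / 2 \<le> ub i0 (fst (X j)) (snd (X j))"
    if "\<forall>k. U (i0 @ [k]) (X j) + V (i0 @ [k]) (Y j) + e \<le> U i0 (X j) + V i0 (Y j)"
      and "wb (i0 @ [k]) (fst (Y j)) (snd (Y j)) \<le> wb i0 (fst (Y j)) (snd (Y j)) + e / 2" for j k
    using that(1)[rule_format, of k] that(2) unfolding UV by linarith
  show False
  proof (cases "\<exists>x. U i0 (T, x) + V i0 (T, x) = theta * ?chi (T, x)")
    case True
    then have S'T: "S' = {T} \<times> UNIV" by (simp add: S'_def)
    have fstT: "fst (X j) = T" "fst (Y j) = T" for j
      using XY(1)[of j] XY(2)[of j] unfolding S'T by auto
    have "\<forall>\<^sub>F j in sequentially. U i0 (X j) + V i0 (Y j) \<le> g i0 (snd (X j)) - g i0 (snd (Y j))"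
      using gap
    proof eventually_elim
      case (elim j)
      have ab: "ub i0 T x \<le> phi j T x" and be: "psi j T x \<le> wb i0 T x" for x
        using above[of T x j] below[of T x j] by (auto simp: S'T)
      note sup = term_super_touch[OF tsuper lsc tame_w T C12_psi psi_eq[of j, unfolded fstT] be e2]
      have "ub (i0 @ [k]) T (snd (X j)) + e / 2 \<le> ub i0 T (snd (X j))" if "enat k < Kbar p" for k
        using combine[OF elim, of k] sup(2)[OF that] unfolding fstT by blast
      from term_sub_touch[OF tsub usc tame_u K T C12_phi phi_eq[of j, unfolded fstT] ab e2 this]
      show ?case using sup(1) unfolding UV fstT by linarith
    qed
    moreover have "(\<lambda>j. g i0 (snd (X j)) - g i0 (snd (Y j))) \<longlonglongrightarrow> g i0 (snd z) - g i0 (snd z)"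
      using XY(4,5) by (intro tendsto_diff continuous_on_tendsto_compose[OF g] tendsto_snd) auto
    \<comment> \<open>Both functions are compared with the same continuous \<open>g\<close>, so the
      positive limit \<open>delta\<close> is at most 0.\<close>
    ultimately have "delta \<le> g i0 (snd z) - g i0 (snd z)"
      using tendsto_le[OF sequentially_bot _ lim] by blast
    then show False using delta by simp
  next
    case False
    then have S'S: "S' = S" by (simp add: S'_def)
    have "fst z \<noteq> T"
    proof
      assume "fst z = T"
      then have "z = (T, snd z)" by (simp add: prod_eq_iff)
      moreover have "U i0 z + V i0 z = theta * ?chi z" using XY(6) by simp
      ultimately show False using False by metis
    qed
    then have zT: "fst z < T" using inS[OF XS(3)] by simp
    have evT: "\<forall>\<^sub>F j in sequentially. fst (X j) < T" "\<forall>\<^sub>F j in sequentially. fst (Y j) < T"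
      using order_tendstoD(2)[OF tendsto_fst[OF XY(4)] zT] order_tendstoD(2)[OF tendsto_fst[OF XY(5)] zT] .
    have ab: "\<forall>t\<in>{0..T}. \<forall>x. ub i0 t x \<le> phi j t x"
      and be: "\<forall>t\<in>{0..T}. \<forall>x. psi j t x \<le> wb i0 t x" for j
      using above[of _ _ j] below[of _ _ j] by (auto simp: S'S S_def)
    \<comment> \<open>The tolerance \<open>delta / 2\<close> is half of what the summand 1 in
      \<open>kappa\<close> produces in the limit.\<close>
    obtain d where d: "0 < d" "\<And>x x' y y'. norm (x - x') < d \<Longrightarrow> f x' y' \<le> f x y + delta / 2 + L * \<bar>y' - y\<bar>"
      using f_uniform[of "delta / 2"] delta by auto
    have "(\<lambda>j. norm (snd (X j) - snd (Y j))) \<longlonglongrightarrow> norm (snd z - snd z)"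
      using XY(4,5) by (intro tendsto_intros)
    then have evd: "\<forall>\<^sub>F j in sequentially. norm (snd (X j) - snd (Y j)) < d"
      using d(1) by (intro order_tendstoD(2)) auto
    have "\<forall>\<^sub>F j in sequentially. (L + 1) * (?th * ?chi (X j) + ?th * ?chi (Y j))
        \<le> delta / 2 + L * \<bar>U i0 (X j) + V i0 (Y j)\<bar> + 2 * L * (r j * (dist (X j) (Y j))\<^sup>2)"
      using gap evT evd
    proof eventually_elim
      case (elim j)
      obtain t x s y where Xj: "X j = (t, x)" and Yj: "Y j = (s, y)" by (metis surj_pair)
      have t: "t \<in> {0..<T}" "s \<in> {0..<T}"
        using inS[OF XS(1)[of j]] inS[OF XS(2)[of j]] elim(2,3) by (auto simp: Xj Yj)
      note Cphi = C12_phi[of j, unfolded Yj fst_conv snd_conv]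
      note Cpsi = C12_psi[of j, unfolded Xj fst_conv snd_conv]
      have pheq: "phi j t x = ub i0 t x" and pseq: "psi j s y = wb i0 s y"
        using phi_eq[of j] psi_eq[of j] by (simp_all add: Xj Yj)
      note sup = visc_super_touch[OF super lsc tame_w Cpsi t(2) pseq be e2]
      have "ub (i0 @ [k]) t x + e / 2 \<le> ub i0 t x" if "enat k < Kbar p" for k
        using combine[OF elim(1), of k] sup(2)[OF that] by (simp add: Xj Yj)
      note sb = visc_sub_touch[OF sub usc tame_u K Cphi t(1) pheq ab e2 this]
      have "ereal (- (- (?th * kappa * chi kappa T n t x) + 2 * r j * (t - s)))
          + ereal (f x (ub i0 t x) - b x \<bullet> (?th *\<^sub>R grad_chi kappa T n t x + (2 * r j) *\<^sub>R (x - y))) \<le> 0"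
        by (rule order_trans[OF add_left_mono[OF Flow_ge] sb[unfolded pheq]])
      then have sb': "- (- (?th * kappa * chi kappa T n t x) + 2 * r j * (t - s))
          + (f x (ub i0 t x) - b x \<bullet> (?th *\<^sub>R grad_chi kappa T n t x + (2 * r j) *\<^sub>R (x - y))) \<le> 0"
        unfolding plus_ereal.simps by (simp only: ereal_less_eq zero_ereal_def)
      have "0 \<le> ereal (- (- (- ?th * kappa * chi kappa T n s y) + 2 * - r j * (s - t)))
          + ereal (f y (wb i0 s y) - b y \<bullet> (- ?th *\<^sub>R grad_chi kappa T n s y + (2 * - r j) *\<^sub>R (y - x)))"
        by (rule order_trans[OF sup(1)[unfolded pseq] add_left_mono[OF Fup_le]])
      then have sup': "0 \<le> - (- (- ?th * kappa * chi kappa T n s y) + 2 * - r j * (s - t))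
          + (f y (wb i0 s y) - b y \<bullet> (- ?th *\<^sub>R grad_chi kappa T n s y + (2 * - r j) *\<^sub>R (y - x)))"
        unfolding plus_ereal.simps by (simp only: ereal_less_eq zero_ereal_def)
      have "(L + 1) * (?th * chi kappa T n t x + ?th * chi kappa T n s y)
          \<le> f y (wb i0 s y) - f x (ub i0 t x) + 2 * L * (r j * (norm (x - y))\<^sup>2)"
        using theta by (intro doubled_inequality[OF _ _ r kappa_def sb' sup']) (auto simp: n_def)
      moreover have "f y (wb i0 s y) \<le> f x (ub i0 t x) + delta / 2 + L * \<bar>wb i0 s y - ub i0 t x\<bar>"
        using elim(4) by (intro d(2)) (simp add: Xj Yj)
      moreover have "2 * L * (r j * (norm (x - y))\<^sup>2) \<le> 2 * L * (r j * (dist (X j) (Y j))\<^sup>2)"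
        using L_nonneg r[of j] unfolding Xj Yj dist_Pair_sq by (intro mult_left_mono) auto
      ultimately show ?case
        by (simp add: Xj Yj U_def V_def abs_minus_commute)
    qed
    moreover have "(\<lambda>j. (L + 1) * (?th * ?chi (X j) + ?th * ?chi (Y j))) \<longlonglongrightarrow> (L + 1) * (?th * ?chi z + ?th * ?chi z)"
      by (intro tendsto_intros chiX chiY)
    moreover have "(\<lambda>j. delta / 2 + L * \<bar>U i0 (X j) + V i0 (Y j)\<bar> + 2 * L * (r j * (dist (X j) (Y j))\<^sup>2))
        \<longlonglongrightarrow> delta / 2 + L * \<bar>delta\<bar> + 2 * L * 0"
      by (intro tendsto_intros lim r0)
    \<comment> \<open>In the limit this reads (L + 1) delta <= delta / 2 + L delta.\<close>
    ultimately have "(L + 1) * (?th * ?chi z + ?th * ?chi z) \<le> delta / 2 + L * \<bar>delta\<bar> + 2 * L * 0"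
      using tendsto_le[OF sequentially_bot] by blast
    then show False using delta by (simp add: delta_def algebra_simps)
  qed
qed

end

section \<open>From the standing assumptions to the reduced setting\<close>

lemma powr_le_wt:
  assumes "0 \<le> q"
  shows "norm x powr q \<le> wt (nat \<lceil>q\<rceil>) x"
proof (cases "norm x \<le> 1")
  case True
  then have "norm x powr q \<le> 1" using assms by (intro powr_le1) auto
  then show ?thesis using wt_ge_1[of "nat \<lceil>q\<rceil>" x] by linarith
next
  case False
  then have "norm x powr q \<le> norm x powr real (nat \<lceil>q\<rceil>)"
    by (intro powr_mono real_nat_ceiling_ge) auto
  also have "\<dots> = norm x ^ nat \<lceil>q\<rceil>" using False by (intro powr_realpow) auto
  also have "\<dots> \<le> wt (nat \<lceil>q\<rceil>) x"
    unfolding wt_def by (intro power_mono norm_le_one_plus_sq) auto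
  finally show ?thesis .
qed

lemma tameI:
  fixes u v :: "nat list \<Rightarrow> real \<Rightarrow> real^'d \<Rightarrow> real"
  assumes q: "0 < q"
    and growth: "\<And>i t x. t \<in> {0..T} \<Longrightarrow> (\<bar>u i t x\<bar> + \<bar>v i t x\<bar>) / (1 + norm x powr q) \<le> M"
    and decay: "\<And>e. 0 < e \<Longrightarrow> \<exists>N. \<forall>i. N \<le> wlen i \<longrightarrow>
      (\<forall>t\<in>{0..T}. \<forall>x. \<bar>u i t x\<bar> + \<bar>v i t x\<bar> \<le> e)"
  shows "tame T (2 * \<bar>M\<bar>) (nat \<lceil>q\<rceil>) u" and "tame T (2 * \<bar>M\<bar>) (nat \<lceil>q\<rceil>) v"
proof -
  have sum_le: "\<bar>u i t x\<bar> + \<bar>v i t x\<bar> \<le> 2 * \<bar>M\<bar> * wt (nat \<lceil>q\<rceil>) x" if "t \<in> {0..T}" for i t x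
  proof -
    have pos: "0 < 1 + norm x powr q" by (simp add: add_pos_nonneg)
    have "\<bar>u i t x\<bar> + \<bar>v i t x\<bar> \<le> M * (1 + norm x powr q)"
      using growth[OF that, of i x] pos by (simp add: pos_divide_le_eq)
    \<comment> \<open>The factor 2 comes from bounding both 1 and |x|^q by the weight.\<close>
    also have "\<dots> \<le> \<bar>M\<bar> * (2 * wt (nat \<lceil>q\<rceil>) x)"
      using powr_le_wt[of q x] wt_ge_1[of "nat \<lceil>q\<rceil>" x] q pos by (intro mult_mono) auto
    finally show ?thesis by (simp add: mult.commute mult.left_commute)
  qed
  have *: "\<bar>u i t x\<bar> \<le> 2 * \<bar>M\<bar> * wt (nat \<lceil>q\<rceil>) x" "\<bar>v i t x\<bar> \<le> 2 * \<bar>M\<bar> * wt (nat \<lceil>q\<rceil>) x"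
    if "t \<in> {0..T}" for i t x
    using sum_le[OF that, of i x] by linarith+
  have "\<exists>N. \<forall>i. N \<le> wlen i \<longrightarrow> (\<forall>t\<in>{0..T}. \<forall>x. \<bar>u i t x\<bar> \<le> e \<and> \<bar>v i t x\<bar> \<le> e)" if e: "0 < e" for e
  proof -
    obtain N where N: "\<forall>i. N \<le> wlen i \<longrightarrow> (\<forall>t\<in>{0..T}. \<forall>x. \<bar>u i t x\<bar> + \<bar>v i t x\<bar> \<le> e)"
      using decay[OF e] ..
    have "\<bar>u i t x\<bar> \<le> e" "\<bar>v i t x\<bar> \<le> e" if "N \<le> wlen i" "t \<in> {0..T}" for i t x
      using N[rule_format, OF that, of x] by linarith+
    then show ?thesis by blast
  qed
  then show "tame T (2 * \<bar>M\<bar>) (nat \<lceil>q\<rceil>) u" "tame T (2 * \<bar>M\<bar>) (nat \<lceil>q\<rceil>) v"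
    using * unfolding tame_def by blast+
qed

theorem theorem4p3:
  fixes T :: real and gam :: real and p :: "nat \<Rightarrow> real"
    and lam :: "real^'d \<Rightarrow> 'a::polish_space \<Rightarrow> real^'d"
    and sig :: "real^'d \<Rightarrow> 'a \<Rightarrow> real^'m^'d"
    and lamY :: "real^'d \<Rightarrow> real \<Rightarrow> 'a \<Rightarrow> real"
    and sigY :: "real^'d \<Rightarrow> 'a \<Rightarrow> real^'m"
    and g :: "nat list \<Rightarrow> real^'d \<Rightarrow> real"
    and w :: "real \<Rightarrow> real" and L :: real
    and wbar ubar :: "nat list \<Rightarrow> real \<Rightarrow> real^'d \<Rightarrow> real"
  assumes T_pos: "0 < T"
    and gam_pos: "0 < gam"
    and p_nonneg: "\<And>k. 0 \<le> p k"
    and p_sums: "p sums 1"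
    and A_bounded: "bounded (UNIV :: 'a set)"
    \<comment> \<open>(H0)\<close>
    and H0_i: "summable (\<lambda>k. real k * p k)"
    and H0_ii: "\<exists>B. \<forall>a. norm (lam 0 a) + norm (sig 0 a) + \<bar>lamY 0 0 a\<bar> + norm (sigY 0 a) \<le> B"
    and H0_iii: "\<And>x x' y y' a. norm (lam x a - lam x' a) + norm (sig x a - sig x' a)
                   + \<bar>lamY x y a - lamY x' y' a\<bar> + norm (sigY x a - sigY x' a)
                   \<le> L * (norm (x - x') + \<bar>y - y'\<bar>)"
    and H0_iv_mono: "mono w"
    and H0_iv_lim: "(w \<longlongrightarrow> 0) (at_right 0)"
    and H0_iv: "\<And>x y a a'. norm (lam x a - lam x a') + norm (sig x a - sig x a')
                   + \<bar>lamY x y a - lamY x y a'\<bar> + norm (sigY x a - sigY x a')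
                   \<le> w (dist a a')"
    \<comment> \<open>(H1)\<close>
    and H1: "\<And>i. continuous_on UNIV (g i)"
    \<comment> \<open>(H3)\<close>
    and H3_i: "\<And>x a a'. lam x a = lam x a' \<and> sig x a = sig x a'"
    and H3_ii: "\<exists>C>0. \<exists>\<eta>>0. \<eta> \<le> 1 \<and> (\<forall>r\<ge>0. w r \<le> C * r powr \<eta>)"
    and H3_iii: "\<exists>C>0. \<forall>eps eps' x x' q q'. 0 \<le> eps \<longrightarrow> 0 \<le> eps' \<longrightarrow>
                   dH (Nset sig sigY eps x q) (Nset sig sigY eps' x' q')
                   \<le> ereal (C * (norm (q - q') + eps + eps') * (1 + norm x) + C * norm (x - x'))"
    and H3_iv: "Nset sig sigY 0 0 0 \<noteq> {}"
    \<comment> \<open>the functions\<close>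
    and wbar_lsc: "\<And>i. lsc_on ({0..T} \<times> UNIV) (\<lambda>(t, x). wbar i t x)"
    and wbar_super: "visc_super T p lam sig lamY sigY wbar"
    and wbar_term: "term_super T p g wbar"
    and ubar_usc: "\<And>i. usc_on ({0..T} \<times> UNIV) (\<lambda>(t, x). ubar i t x)"
    and ubar_sub: "visc_sub T p lam sig lamY sigY ubar"
    and ubar_term: "term_sub T p g ubar"
    and growth: "\<exists>q>0. \<exists>M. \<forall>i. \<forall>t\<in>{0..T}. \<forall>x.
                   (\<bar>wbar i t x\<bar> + \<bar>ubar i t x\<bar>) / (1 + norm x powr q) \<le> M"
    and decay: "\<forall>e>0. \<exists>N. \<forall>i. N \<le> wlen i \<longrightarrow>
                   (\<forall>t\<in>{0..T}. \<forall>x. \<bar>wbar i t x\<bar> + \<bar>ubar i t x\<bar> \<le> e)"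
  shows "\<forall>i. \<forall>t\<in>{0..T}. \<forall>x. ubar i t x \<le> wbar i t x"
proof -
  obtain B where B: "\<And>a. norm (lam 0 a) + norm (sig 0 a) + \<bar>lamY 0 0 a\<bar> + norm (sigY 0 a) \<le> B"
    using H0_ii by blast
  obtain C where C: "0 < C" and near: "\<And>eps eps' x x' q q'. 0 \<le> eps \<Longrightarrow> 0 \<le> eps' \<Longrightarrow>
      dH (Nset sig sigY eps x q) (Nset sig sigY eps' x' q')
      \<le> ereal (C * (norm (q - q') + eps + eps') * (1 + norm x) + C * norm (x - x'))"
    using H3_iii by blast
  \<comment> \<open>(H3)(iii) is applied with the same set on both sides, where its bound is
    zero.\<close>
  have nonempty: "Nset sig sigY 0 x q \<noteq> {}" for x q
    by (rule dH_finite_imp_nonempty(1)[OF near[of 0 0 x q x q]]) simp_all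
  have L: "0 \<le> L"
  proof -
    have "\<bar>lamY 0 1 undefined - lamY 0 0 undefined\<bar> \<le> L" using H0_iii[of 0 undefined 0 1 0] by simp
    then show ?thesis by linarith
  qed
  have sig0: "sig x a = 0" for x a
  \<comment> \<open>The bound may depend on \<open>x\<close>, as long as it is uniform in the
    gradient variable.\<close>
  proof (rule volatility_zero[where sig = sig and sigY = sigY and x = x and B = "B + L * norm x"])
    show "sig x a = sig x a'" for a a' using H3_i[of x a a'] by blast
    show "norm (sigY x a) \<le> B + L * norm x" for a
    proof -
      have "norm (sigY x a) \<le> norm (sigY 0 a) + norm (sigY x a - sigY 0 a)" by (rule norm_triangle_sub)
      moreover have "norm (sigY x a - sigY 0 a) \<le> L * norm x"
        using H0_iii[of x a 0 0 0] norm_ge_zero[of "lam x a - lam 0 a"] norm_ge_zero[of "sig x a - sig 0 a"]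
          abs_ge_zero[of "lamY x 0 a - lamY 0 0 a"] by (simp del: norm_ge_zero abs_ge_zero)
      moreover have "norm (sigY 0 a) \<le> B"
        using B[of a] norm_ge_zero[of "lam 0 a"] norm_ge_zero[of "sig 0 a"] abs_ge_zero[of "lamY 0 0 a"] by linarith
      ultimately show ?thesis by linarith
    qed
  qed (rule nonempty)
  \<comment> \<open>The drift does not depend on the control, so \<open>undefined\<close> is just a
    fixed reference control.\<close>
  interpret drift_control lam sig lamY sigY "\<lambda>x. lam x undefined" w B C L
  proof
    show "lam x a = lam x undefined" for x a using H3_i[of x a undefined] by blast
    show "\<bar>lamY 0 0 a\<bar> \<le> B" for a
      using B[of a] norm_ge_zero[of "lam 0 a"] norm_ge_zero[of "sig 0 a"] norm_ge_zero[of "sigY 0 a"] by linarith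
    show "norm (lam x undefined - lam x' undefined) \<le> L * norm (x - x')" for x x'
      using H0_iii[of x undefined x' 0 0] norm_ge_zero[of "sig x undefined - sig x' undefined"]
        norm_ge_zero[of "sigY x undefined - sigY x' undefined"]
        abs_ge_zero[of "lamY x 0 undefined - lamY x' 0 undefined"] by (simp del: norm_ge_zero abs_ge_zero)
    show "\<bar>lamY x y a - lamY x' y' a\<bar> \<le> L * (norm (x - x') + \<bar>y - y'\<bar>)" for x y a x' y'
      using H0_iii[of x a x' y y'] norm_ge_zero[of "sig x a - sig x' a"]
        norm_ge_zero[of "sigY x a - sigY x' a"] norm_ge_zero[of "lam x a - lam x' a"] by linarith
    show "\<bar>lamY x y a - lamY x y a'\<bar> \<le> w r" if "dist a a' \<le> r" for a a' r x y
      using H0_iv[of x a a' y] monoD[OF H0_iv_mono that] norm_ge_zero[of "sig x a - sig x a'"]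
        norm_ge_zero[of "sigY x a - sigY x a'"] norm_ge_zero[of "lam x a - lam x a'"] by linarith
    show "\<exists>a'\<in>Nset sig sigY eps' x' 0. dist a a' \<le> r"
      if "0 \<le> eps" "0 \<le> eps'" "C * (eps + eps') * (1 + norm x) + C * norm (x - x') < r"
        "a \<in> Nset sig sigY eps x 0" for eps eps' x x' r a
    proof (rule dH_lessD[OF _ that(4)])
      show "dH (Nset sig sigY eps x 0) (Nset sig sigY eps' x' 0) < ereal r"
        using near[OF that(1,2), of x 0 x' 0] that(3) by (auto elim!: order_le_less_trans)
    qed
  qed (fact L sig0 H0_iv_lim C nonempty)+
  from growth obtain q M where q: "0 < q"
    and M: "\<And>i t x. t \<in> {0..T} \<Longrightarrow> (\<bar>wbar i t x\<bar> + \<bar>ubar i t x\<bar>) / (1 + norm x powr q) \<le> M"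
    by blast
  note tame = tameI[of q T wbar ubar M, OF q M decay[rule_format]]
  have "enat 0 < Kbar p" by (rule Kbar_pos[OF p_sums p_nonneg])
  from comparison[OF T_pos this H1 wbar_lsc ubar_usc wbar_super ubar_sub wbar_term ubar_term tame]
  show ?thesis by blast
qed

end
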